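(* There are two inner functions $B$ and $\Theta$ on the upper half-plane $\mathbb{C}_+$ and an analytic function $\Psi$ on $\mathbb{C}_+$ with $\Psi \not\equiv 0$ such that $\mathscr{M}(B,\Theta) = \mathbb{C}\Psi$ but $\Psi\mathscr{K}_B \subsetneq \mathscr{K}_\Theta$.
   Context: $\mathbb{C}_+$ is the open upper half-plane and $\mathscr{H}^2$ is the Hardy space of $\mathbb{C}_+$. For an inner function $U$ on $\mathbb{C}_+$, the model space is $\mathscr{K}_U := \mathscr{H}^2 \cap (U\mathscr{H}^2)^{\perp}$. For inner functions $U,V$ on $\mathbb{C}_+$, $\mathscr{M}(U,V) := \{\Phi \in \operatorname{Hol}(\mathbb{C}_+) : \Phi\mathscr{K}_U \subseteq \mathscr{K}_V\}$. $\mathbb{C}\Psi$ denotes the set of constant multiples of $\Psi$. *)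

theory Defs
  imports "HOL-Complex_Analysis.Complex_Analysis"
begin

definition upper_half_plane :: "complex set" where
  "upper_half_plane = {z. Im z > 0}"

(* A function on the upper half-plane is represented by its extension by 0 to the whole
   complex plane, so that equality of HOL functions is equality on the half-plane and
   pointwise products and scalar multiples stay within the representation. *)
definition Hol :: "(complex \<Rightarrow> complex) set" where
  "Hol = {f. f holomorphic_on upper_half_plane \<and> (\<forall>z. z \<notin> upper_half_plane \<longrightarrow> f z = 0)}"

definition hardy2 :: "(complex \<Rightarrow> complex) set" where
  "hardy2 = {f \<in> Hol.
     (SUP y\<in>{0::real<..}. \<integral>\<^sup>+ x. ennreal ((cmod (f (Complex x y)))\<^sup>2) \<partial>lborel) < \<infinity>}"

(* The inner product of the Hilbert space hardy2. For f in hardy2 the integral of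
   |f (x + i y)|^2 increases to its supremum (the squared norm of f) as y decreases to 0;
   by polarization the limit below exists for all f, g in hardy2, and it is the
   L^2 inner product on the real line of the boundary functions of f and g. *)
definition hardy_inner :: "(complex \<Rightarrow> complex) \<Rightarrow> (complex \<Rightarrow> complex) \<Rightarrow> complex" where
  "hardy_inner f g =
     Lim (at_right 0) (\<lambda>y::real. \<integral>x. f (Complex x y) * cnj (g (Complex x y)) \<partial>lborel)"

definition stolz_angle :: "real \<Rightarrow> real \<Rightarrow> complex set" where
  "stolz_angle a x = {z. Im z > 0 \<and> \<bar>Re z - x\<bar> < a * Im z}"

definition has_nontangential_limit :: "(complex \<Rightarrow> complex) \<Rightarrow> complex \<Rightarrow> real \<Rightarrow> bool" where
  "has_nontangential_limit f l x \<longleftrightarrow>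
     (\<forall>a>0. (f \<longlongrightarrow> l) (at (of_real x) within stolz_angle a x))"

(* Unimodular constants count as inner functions. *)
definition inner_function :: "(complex \<Rightarrow> complex) \<Rightarrow> bool" where
  "inner_function U \<longleftrightarrow> U \<in> Hol \<and> bounded (U ` upper_half_plane) \<and>
     (AE x in lborel. \<exists>l. cmod l = 1 \<and> has_nontangential_limit U l x)"

definition pmult :: "(complex \<Rightarrow> complex) \<Rightarrow> (complex \<Rightarrow> complex) \<Rightarrow> (complex \<Rightarrow> complex)" where
  "pmult \<Phi> f = (\<lambda>z. \<Phi> z * f z)"

definition model_space :: "(complex \<Rightarrow> complex) \<Rightarrow> (complex \<Rightarrow> complex) set" where
  "model_space U = {f \<in> hardy2. \<forall>h \<in> pmult U ` hardy2. hardy_inner f h = 0}"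

definition multipliers ::
    "(complex \<Rightarrow> complex) \<Rightarrow> (complex \<Rightarrow> complex) \<Rightarrow> (complex \<Rightarrow> complex) set" where
  "multipliers U V = {\<Phi> \<in> Hol. pmult \<Phi> ` model_space U \<subseteq> model_space V}"

definition const_multiples :: "(complex \<Rightarrow> complex) \<Rightarrow> (complex \<Rightarrow> complex) set" where
  "const_multiples \<Psi> = {\<lambda>z. c * \<Psi> z | c. True}"

end

theory Submission
  imports Defs "HOL-Probability.Sinc_Integral"
begin

text \<open>
  Fix the points 0, 1, 2, ... on the real axis and weights \<open>m k > 0\<close> with finite sum. The function
  \<open>G z = \<Sum>k. m k / (k - z)\<close> has positive imaginary part in the upper half-plane and is real on the real
  axis away from the points, so \<open>U = (G - \<i>) / (G + \<i>)\<close> is inner; the weights are its Clark measure.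
  By Clark's theorem the model space of \<open>U\<close> consists of the functions
  \<open>(\<Sum>k. c k / (z - k)) / (G z + \<i>)\<close> with \<open>\<Sum>k. \<bar>c k\<bar>\<^sup>2 / m k\<close> finite. Take two weight sequences \<open>m1\<close>, \<open>m2\<close> on the
  same points, with \<open>m1\<close> decaying much faster, and let \<open>G1\<close>, \<open>G2\<close>, \<open>B\<close>, \<open>\<Theta>\<close> be the resulting
  functions. Multiplication by \<open>\<Psi> = (G1 + \<i>) / (G2 + \<i>)\<close> preserves the coefficients, so it maps the
  model space of \<open>B\<close> into that of \<open>\<Theta>\<close>. The image is proper, as the second space admits larger coefficients.

  There is no other multiplier. If \<open>\<Phi>\<close> is one, put \<open>\<phi> = \<Phi> / \<Psi>\<close>. Multiplying the element with the single
  coefficient 1 at \<open>n\<close> shows that \<open>\<phi> z / (z - n)\<close> is a sum \<open>\<Sum>k. d n k / (z - k)\<close>, for every \<open>n\<close>. The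
  formula for \<open>n\<close> says that \<open>\<phi>\<close> has residue 0 at \<open>n\<close>; the formula for 0 gives the residue \<open>n * d 0 n\<close> there. So \<open>d 0\<close>
  is supported at 0 and \<open>\<phi>\<close> is constant (\<open>multiplier_imp_const_multiple\<close>).

  What is proved of Clark's theorem is two one-sided statements, and the freedom in the weights absorbs the gap
  between them. Rapidly decreasing coefficients do give elements of the model space
  (\<open>synth_in_model_space\<close>): on the real axis \<open>U\<close> times the conjugate of such an element is again such
  an element, hence orthogonal to conjugates of Hardy functions. Conversely every element has an expansion with \<open>c k = O(sqrt (m k))\<close>
  (\<open>model_space_imp_synth\<close>): the reproducing kernel of the model space is itself a combination of the elements with one
  coefficient, and pairing with it recovers the element by Cauchy's formula.

  The inner product is a limit of integrals over horizontal lines. Its existence for a general Hardy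
  function \<open>f\<close> and a function \<open>g\<close> with a dominated boundary limit (\<open>hardy2_tame_pairing_converges\<close>) rests on
  the invariance of \<open>\<integral>x. f (x + \<i> * s) * cnj (g (x + \<i> * t))\<close> under changes of \<open>s\<close> and \<open>t\<close> that keep
  \<open>s + t\<close>, which is Cauchy's theorem in a strip (\<open>line_integral_shift\<close>).
\<close>

section \<open>Line integrals in a strip\<close>

lemma has_bochner_integral_poisson_kernel:
  fixes a b :: real
  assumes "b > 0"
  shows "has_bochner_integral lborel (\<lambda>x. 1 / ((x - a)\<^sup>2 + b\<^sup>2)) (pi / b)"
proof -
  have "has_bochner_integral lborel (\<lambda>x::real. inverse (1 + x\<^sup>2)) pi"
    using integrable_inverse_1_plus_square LBINT_inverse_1_plus_square
    by (simp add: has_bochner_integral_iff set_integrable_def interval_lebesgue_integral_def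
        set_lebesgue_integral_def)
  then have "has_bochner_integral lborel
      (\<lambda>x::real. inverse (1 + (- a / b + (1 / b) * x)\<^sup>2)) (pi /\<^sub>R \<bar>1 / b\<bar>)"
    using assms by (subst (asm) lborel_has_bochner_integral_real_affine_iff[of "1 / b" _ _ "- a / b"]) auto
  then have "has_bochner_integral lborel
      (\<lambda>x::real. inverse (1 + (- a / b + (1 / b) * x)\<^sup>2) * (1 / b\<^sup>2)) ((pi /\<^sub>R \<bar>1 / b\<bar>) * (1 / b\<^sup>2))"
    by (rule has_bochner_integral_mult_left)
  moreover have "inverse (1 + (- a / b + (1 / b) * x)\<^sup>2) * (1 / b\<^sup>2) = 1 / ((x - a)\<^sup>2 + b\<^sup>2)" for x
  proof -
    have "(- a / b + (1 / b) * x)\<^sup>2 = (x - a)\<^sup>2 / b\<^sup>2"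
      using assms by (simp add: field_simps)
    moreover have "1 + (x - a)\<^sup>2 / b\<^sup>2 = ((x - a)\<^sup>2 + b\<^sup>2) / b\<^sup>2"
      using assms by (simp add: field_simps)
    ultimately show ?thesis
      using assms by simp
  qed
  ultimately show ?thesis
    using assms by (simp add: power2_eq_square)
qed

lemma Cauchy_Schwarz_integral:
  fixes u v :: "'a \<Rightarrow> complex"
  assumes [measurable]: "u \<in> borel_measurable M" "v \<in> borel_measurable M"
    and u: "integrable M (\<lambda>x. (cmod (u x))\<^sup>2)" and v: "integrable M (\<lambda>x. (cmod (v x))\<^sup>2)"
  shows "integrable M (\<lambda>x. u x * v x)"
    and "(\<integral>x. cmod (u x * v x) \<partial>M) \<le> sqrt (\<integral>x. (cmod (u x))\<^sup>2 \<partial>M) * sqrt (\<integral>x. (cmod (v x))\<^sup>2 \<partial>M)"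
proof -
  let ?U = "\<integral>x. (cmod (u x))\<^sup>2 \<partial>M" and ?V = "\<integral>x. (cmod (v x))\<^sup>2 \<partial>M"
  show int: "integrable M (\<lambda>x. u x * v x)"
  proof (rule Bochner_Integration.integrable_bound)
    show "integrable M (\<lambda>x. (cmod (u x))\<^sup>2 + (cmod (v x))\<^sup>2)"
      using u v by simp
    have "cmod (u x * v x) \<le> (cmod (u x))\<^sup>2 + (cmod (v x))\<^sup>2" for x
    proof -
      have "0 \<le> cmod (u x) * cmod (v x)"
        by simp
      then show ?thesis
        using sum_squares_bound[of "cmod (u x)" "cmod (v x)"] unfolding norm_mult by linarith
    qed
    then show "AE x in M. norm (u x * v x) \<le> norm ((cmod (u x))\<^sup>2 + (cmod (v x))\<^sup>2)"
      by simp
  qed simp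
  have "(\<integral>\<^sup>+x. ennreal (cmod (u x)) * ennreal (cmod (v x)) \<partial>M)\<^sup>2
      \<le> (\<integral>\<^sup>+x. ennreal (cmod (u x)) ^ 2 \<partial>M) * (\<integral>\<^sup>+x. ennreal (cmod (v x)) ^ 2 \<partial>M)"
    by (rule Cauchy_Schwarz_nn_integral) auto
  moreover have "(\<integral>\<^sup>+x. ennreal (cmod (u x)) * ennreal (cmod (v x)) \<partial>M) = ennreal (\<integral>x. cmod (u x * v x) \<partial>M)"
    using nn_integral_eq_integral[OF integrable_norm[OF int]] by (simp add: norm_mult ennreal_mult)
  moreover have "(\<integral>\<^sup>+x. ennreal (cmod (u x)) ^ 2 \<partial>M) = ennreal ?U"
    using u by (subst nn_integral_eq_integral[symmetric]) (auto simp: ennreal_power)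
  moreover have "(\<integral>\<^sup>+x. ennreal (cmod (v x)) ^ 2 \<partial>M) = ennreal ?V"
    using v by (subst nn_integral_eq_integral[symmetric]) (auto simp: ennreal_power)
  ultimately have "(\<integral>x. cmod (u x * v x) \<partial>M)\<^sup>2 \<le> ?U * ?V"
    by (simp add: ennreal_power ennreal_mult[symmetric])
  then show "(\<integral>x. cmod (u x * v x) \<partial>M) \<le> sqrt ?U * sqrt ?V"
    by (simp add: real_le_rsqrt flip: real_sqrt_mult)
qed

lemma Complex_eq_add: "Complex x y = of_real x + \<i> * of_real y"
  by (simp add: complex_eq_iff)

lemma continuous_on_Complex [continuous_intros]:
  assumes "continuous_on S f" "continuous_on S g"
  shows "continuous_on S (\<lambda>x. Complex (f x) (g x))"
  unfolding Complex_eq_add by (intro continuous_intros assms)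

text \<open>
  Stated with the nonnegative integral so that Tonelli applies to it directly.
\<close>

lemma norm_vertical_increment_le:
  fixes P :: "complex \<Rightarrow> complex"
  assumes P: "\<And>y. s \<le> y \<Longrightarrow> y \<le> t \<Longrightarrow> (P has_field_derivative H (Complex x y)) (at (Complex x y))"
    and cont: "continuous_on {s..t} (\<lambda>y. H (Complex x y))" and "s \<le> t"
  shows "ennreal (cmod (P (Complex x t) - P (Complex x s)))
           \<le> (\<integral>\<^sup>+y. ennreal (cmod (H (Complex x y))) * indicator {s..t} y \<partial>lborel)"
proof -
  have "((\<lambda>y. P (Complex x y)) has_vector_derivative \<i> * H (Complex x y)) (at y within {s..t})"
    if "s \<le> y" "y \<le> t" for y
  proof -
    have "((\<lambda>y. Complex x y) has_vector_derivative \<i>) (at y within {s..t})"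
      unfolding Complex_eq_add by (auto intro!: derivative_eq_intros has_vector_derivative_real_field)
    from field_vector_diff_chain_within[OF this has_field_derivative_at_within[OF P]] that
    show ?thesis by (auto simp: o_def)
  qed
  then have I: "((\<lambda>y. \<i> * H (Complex x y)) has_integral (P (Complex x t) - P (Complex x s))) {s..t}"
    using \<open>s \<le> t\<close> by (intro fundamental_theorem_of_calculus) auto
  have ci: "(\<lambda>y. \<i> * H (Complex x y)) absolutely_integrable_on {s..t}"
    using cont by (intro absolutely_integrable_continuous_real continuous_intros)
  then have "cmod (P (Complex x t) - P (Complex x s)) \<le> integral {s..t} (\<lambda>y. cmod (\<i> * H (Complex x y)))"
    using integral_norm_bound_integral[of "\<lambda>y. \<i> * H (Complex x y)" "{s..t}" "\<lambda>y. cmod (\<i> * H (Complex x y))"]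
    unfolding absolutely_integrable_on_def integral_unique[OF I] by simp
  also have "\<dots> = integral {s..t} (\<lambda>y. cmod (H (Complex x y)))"
    by (simp add: norm_mult)
  finally have le: "cmod (P (Complex x t) - P (Complex x s)) \<le> integral {s..t} (\<lambda>y. cmod (H (Complex x y)))" .
  have "(\<lambda>y. cmod (H (Complex x y))) integrable_on {s..t}"
    using cont by (intro integrable_continuous_real continuous_intros)
  then have hi: "((\<lambda>y. cmod (H (Complex x y))) has_integral integral {s..t} (\<lambda>y. cmod (H (Complex x y)))) {s..t}"
    by (rule integrable_integral)
  have "(\<integral>\<^sup>+y. ennreal (cmod (H (Complex x y))) * indicator {s..t} y \<partial>lborel)
     = (\<integral>\<^sup>+y. ennreal (indicator {s..t} y *\<^sub>R cmod (H (Complex x y))) \<partial>lborel)"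
    by (intro nn_integral_cong) (auto split: split_indicator)
  also have "\<dots> = ennreal (integral {s..t} (\<lambda>y. cmod (H (Complex x y))))"
  proof (rule nn_integral_has_integral_lborel)
    show "(\<lambda>y. indicator {s..t} y *\<^sub>R cmod (H (Complex x y))) \<in> borel_measurable borel"
      using cont by (intro borel_measurable_continuous_on_indicator continuous_intros) auto
    show "((\<lambda>y. indicator {s..t} y *\<^sub>R cmod (H (Complex x y))) has_integral integral {s..t} (\<lambda>y. cmod (H (Complex x y)))) UNIV"
    proof -
      have "(\<lambda>y. indicator {s..t} y *\<^sub>R cmod (H (Complex x y)))
          = (\<lambda>y. if y \<in> {s..t} then cmod (H (Complex x y)) else 0)"
        by (auto simp: fun_eq_iff indicator_def)
      then show ?thesis
        using hi by (simp only: has_integral_restrict_UNIV)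
    qed
  qed auto
  finally show ?thesis
    using le by (simp add: ennreal_leI)
qed

lemma line_integral_truncation:
  fixes f :: "real \<Rightarrow> complex"
  assumes f: "integrable lborel f"
  shows "((\<lambda>R. \<integral>x. indicator {-R..R} x *\<^sub>R f x \<partial>lborel) \<longlongrightarrow> (\<integral>x. f x \<partial>lborel)) at_top"
proof (rule integral_dominated_convergence_at_top[where w = "\<lambda>x. cmod (f x)"])
  show "AE x in lborel. ((\<lambda>R. indicator {-R..R} x *\<^sub>R f x) \<longlongrightarrow> f x) at_top"
  proof (intro AE_I2 tendsto_eventually)
    fix x :: real
    show "\<forall>\<^sub>F R in at_top. indicator {-R..R} x *\<^sub>R f x = f x"
      using eventually_ge_at_top[of "\<bar>x\<bar>"]
      by eventually_elim (auto simp: indicator_def)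
  qed
qed (use f in \<open>auto simp: indicator_def\<close>)

lemma line_integral_primitive:
  fixes P H :: "complex \<Rightarrow> complex"
  assumes P: "\<And>x. (P has_field_derivative H (Complex x y)) (at (Complex x y))"
    and cont: "continuous_on UNIV (\<lambda>x. H (Complex x y))" and "0 \<le> R"
  shows "(\<integral>x. indicator {-R..R} x *\<^sub>R H (Complex x y) \<partial>lborel) = P (Complex R y) - P (Complex (-R) y)"
proof (rule integral_FTC_atLeastAtMost)
  show "((\<lambda>x. P (Complex x y)) has_vector_derivative H (Complex x y)) (at x within {-R..R})" for x
  proof -
    have "((\<lambda>x. Complex x y) has_vector_derivative 1) (at x within {-R..R})"
      unfolding Complex_eq_add by (auto intro!: derivative_eq_intros has_vector_derivative_real_field)
    from field_vector_diff_chain_within[OF this has_field_derivative_at_within[OF P]]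
    show ?thesis by (auto simp: o_def)
  qed
qed (use assms in \<open>auto intro: continuous_on_subset\<close>)

text \<open>
  A primitive \<open>P\<close> of \<open>H\<close> turns the two line integrals, cut off at \<open>R\<close>, into differences of values
  of \<open>P\<close>; what separates them is \<open>A R - A (-R)\<close>, where \<open>A x\<close> is, up to the factor \<open>\<i>\<close>, the integral of
  \<open>H\<close> over a vertical segment. By Tonelli the bound makes \<open>A\<close> integrable near infinity, so
  \<open>A R - A (-R)\<close> cannot tend to a nonzero limit. Bounding \<open>H\<close> only for \<open>\<bar>x\<bar> \<ge> r\<close> keeps removable
  singularities out of the estimates in applications.
\<close>

lemma line_integral_shift:
  fixes H :: "complex \<Rightarrow> complex"
  assumes hol: "H holomorphic_on {z. a < Im z \<and> Im z < b}" and ab: "a < s" "s \<le> t" "t < b"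
    and ints: "integrable lborel (\<lambda>x. H (Complex x s))"
    and intt: "integrable lborel (\<lambda>x. H (Complex x t))"
    and bd: "\<And>y. s \<le> y \<Longrightarrow> y \<le> t \<Longrightarrow>
      (\<integral>\<^sup>+x. ennreal (cmod (H (Complex x y))) * indicator {x. r \<le> \<bar>x\<bar>} x \<partial>lborel) \<le> ennreal C"
  shows "(\<integral>x. H (Complex x s) \<partial>lborel) = (\<integral>x. H (Complex x t) \<partial>lborel)"
proof (rule ccontr)
  assume ne: "(\<integral>x. H (Complex x s) \<partial>lborel) \<noteq> (\<integral>x. H (Complex x t) \<partial>lborel)"
  let ?S = "{z. a < Im z \<and> Im z < b}"
  have S: "?S = {z. a < Im z} \<inter> {z. Im z < b}" by auto
  have opS: "open ?S" unfolding S by (intro open_Int open_halfspace_Im_gt open_halfspace_Im_lt)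
  have cvS: "convex ?S" unfolding S by (intro convex_Int convex_halfspace_Im_gt convex_halfspace_Im_lt)
  obtain P where P0: "\<And>z. z \<in> ?S \<Longrightarrow> (P has_field_derivative H z) (at z within ?S)"
    by (rule holomorphic_convex_primitive'[OF cvS opS hol]) blast
  have P: "(P has_field_derivative H (Complex x y)) (at (Complex x y))" if "s \<le> y" "y \<le> t" for x y
  proof -
    have "Complex x y \<in> ?S" using that ab by simp
    from P0[OF this] show ?thesis by (simp only: at_within_open[OF \<open>Complex x y \<in> ?S\<close> opS])
  qed
  have contH: "continuous_on ?S H" using hol by (rule holomorphic_on_imp_continuous_on)
  have contP: "continuous_on ?S P"
    using P0 by (rule DERIV_continuous_on)
  have contHx: "continuous_on UNIV (\<lambda>x. H (Complex x y))" if "s \<le> y" "y \<le> t" for y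
    using that ab by (intro continuous_on_compose2[OF contH] continuous_intros) auto
  have contHy: "continuous_on {s..t} (\<lambda>y. H (Complex x y))" for x
    using ab by (intro continuous_on_compose2[OF contH] continuous_intros) auto
  have contHxy: "continuous_on (UNIV \<times> {s..t}) (\<lambda>(x, y). H (Complex x y))"
    using ab by (auto simp: split_beta intro!: continuous_on_compose2[OF contH] continuous_intros)
  define A where "A x = P (Complex x t) - P (Complex x s)" for x
  have contA: "continuous_on UNIV A"
    unfolding A_def using ab
    by (intro continuous_intros continuous_on_compose2[OF contP]) auto
  then have [measurable]: "A \<in> borel_measurable borel"
    by (rule borel_measurable_continuous_onI)
  define D where "D = (\<integral>x. H (Complex x t) \<partial>lborel) - (\<integral>x. H (Complex x s) \<partial>lborel)"
  have D: "cmod D > 0" using ne by (auto simp: D_def)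
  have lim: "((\<lambda>R. A R - A (-R)) \<longlongrightarrow> D) at_top"
  proof (rule Lim_transform_eventually)
    show "((\<lambda>R. (\<integral>x. indicator {-R..R} x *\<^sub>R H (Complex x t) \<partial>lborel)
        - (\<integral>x. indicator {-R..R} x *\<^sub>R H (Complex x s) \<partial>lborel)) \<longlongrightarrow> D) at_top"
      unfolding D_def by (intro tendsto_diff line_integral_truncation ints intt)
    show "\<forall>\<^sub>F R in at_top. (\<integral>x. indicator {-R..R} x *\<^sub>R H (Complex x t) \<partial>lborel)
        - (\<integral>x. indicator {-R..R} x *\<^sub>R H (Complex x s) \<partial>lborel) = A R - A (- R)"
      using eventually_ge_at_top[of 0]
    proof eventually_elim
      case (elim R)
      show ?case
        using elim ab unfolding A_def
        by (subst (1 2) line_integral_primitive[of P H, OF P contHx]) (auto simp: algebra_simps)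
    qed
  qed
  have tail: "(\<integral>\<^sup>+x. ennreal (cmod (A x)) * indicator {x. r \<le> \<bar>x\<bar>} x \<partial>lborel) \<le> ennreal C * ennreal (t - s)"
  proof -
    let ?h = "\<lambda>x y. ennreal (cmod (H (Complex x y))) * indicator {s..t} y * indicator {x. r \<le> \<bar>x\<bar>} x"
    have [measurable]: "(\<lambda>(x, y). ennreal (cmod (H (Complex x y))) * indicator {s..t} y) \<in> borel_measurable (borel \<Otimes>\<^sub>M borel)"
    proof -
      have "(\<lambda>p. indicator (UNIV \<times> {s..t}) p *\<^sub>R cmod ((\<lambda>(x, y). H (Complex x y)) p)) \<in> borel_measurable borel"
        using contHxy by (intro borel_measurable_continuous_on_indicator continuous_intros) (auto simp: borel_prod[symmetric])
      then have "(\<lambda>p. ennreal (indicator (UNIV \<times> {s..t}) p *\<^sub>R cmod ((\<lambda>(x, y). H (Complex x y)) p))) \<in> borel_measurable (borel \<Otimes>\<^sub>M borel)"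
        by (simp add: borel_prod)
      also have "(\<lambda>p. ennreal (indicator (UNIV \<times> {s..t}) p *\<^sub>R cmod ((\<lambda>(x, y). H (Complex x y)) p)))
        = (\<lambda>(x, y). ennreal (cmod (H (Complex x y))) * indicator {s..t} y)"
        by (auto simp: fun_eq_iff indicator_def)
      finally show ?thesis .
    qed
    have "(\<integral>\<^sup>+x. ennreal (cmod (A x)) * indicator {x. r \<le> \<bar>x\<bar>} x \<partial>lborel)
      \<le> (\<integral>\<^sup>+x. (\<integral>\<^sup>+y. ennreal (cmod (H (Complex x y))) * indicator {s..t} y \<partial>lborel) * indicator {x. r \<le> \<bar>x\<bar>} x \<partial>lborel)"
      unfolding A_def using ab
      by (intro nn_integral_mono mult_right_mono norm_vertical_increment_le P contHy) auto
    also have "\<dots> = (\<integral>\<^sup>+x. (\<integral>\<^sup>+y. ?h x y \<partial>lborel) \<partial>lborel)"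
      using contHy by (intro nn_integral_cong nn_integral_multc[symmetric]) measurable
    also have "\<dots> = (\<integral>\<^sup>+y. (\<integral>\<^sup>+x. ?h x y \<partial>lborel) \<partial>lborel)"
      by (intro lborel_pair.Fubini'[symmetric]) measurable
    also have "\<dots> \<le> (\<integral>\<^sup>+y. ennreal C * indicator {s..t} y \<partial>lborel)"
    proof (intro nn_integral_mono)
      fix y
      show "(\<integral>\<^sup>+x. ?h x y \<partial>lborel) \<le> ennreal C * indicator {s..t} y"
        using bd[of y] by (cases "y \<in> {s..t}") (auto simp: mult_ac)
    qed
    also have "\<dots> = ennreal C * ennreal (t - s)"
      using ab by (simp add: nn_integral_cmult_indicator)
    finally show ?thesis .
  qed
  have "\<forall>\<^sub>F R in at_top. cmod D / 2 < cmod (A R - A (-R))"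
    using order_tendstoD(1)[OF tendsto_norm[OF lim], of "cmod D / 2"] D by simp
  then obtain R1 where R1: "\<And>R. R \<ge> R1 \<Longrightarrow> cmod D / 2 < cmod (A R - A (-R))"
    unfolding eventually_at_top_linorder by blast
  define T where "T = (\<integral>\<^sup>+x. ennreal (cmod (A x)) * indicator {x. r \<le> \<bar>x\<bar>} x \<partial>lborel)"
  have reflect: "(\<integral>\<^sup>+x. ennreal (cmod (A (-x))) * indicator {x. r \<le> \<bar>x\<bar>} x \<partial>lborel) = T"
    unfolding T_def by (subst nn_integral_real_affine[of _ "-1" 0]) (auto simp: indicator_def)
  \<comment> \<open>Both \<open>\<bar>A x\<bar>\<close> and \<open>\<bar>A (-x)\<bar>\<close> are integrable near infinity, but their sum exceeds \<open>\<bar>D\<bar> / 2\<close> on a half-line.\<close>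
  define M where "M = max r R1"
  have "ennreal (cmod D / 2) * ennreal L \<le> T + T" if "L \<ge> 0" for L
  proof -
    have "ennreal (cmod D / 2) * ennreal L = (\<integral>\<^sup>+x. ennreal (cmod D / 2) * indicator {M..M + L} x \<partial>lborel)"
      using that by (simp add: nn_integral_cmult_indicator)
    also have "\<dots> \<le> (\<integral>\<^sup>+x. ennreal (cmod (A x)) * indicator {x. r \<le> \<bar>x\<bar>} x
         + ennreal (cmod (A (-x))) * indicator {x. r \<le> \<bar>x\<bar>} x \<partial>lborel)"
    proof (intro nn_integral_mono)
      fix x
      show "ennreal (cmod D / 2) * indicator {M..M + L} x
          \<le> ennreal (cmod (A x)) * indicator {x. r \<le> \<bar>x\<bar>} x
         + ennreal (cmod (A (-x))) * indicator {x. r \<le> \<bar>x\<bar>} x"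
      proof (cases "x \<in> {M..M+L}")
        case True
        then have "r \<le> \<bar>x\<bar>" "R1 \<le> x" by (auto simp: M_def)
        then show ?thesis
          using R1[of x] True norm_triangle_ineq4[of "A x" "A (-x)"]
          by (simp flip: ennreal_plus) 
      qed simp
    qed
    also have "\<dots> = T + T"
      by (subst nn_integral_add) (auto simp: T_def[symmetric] reflect)
    finally show ?thesis .
  qed
  moreover obtain T' where T': "T + T = ennreal T'" "T' \<ge> 0"
    using tail by (cases "T + T") (auto simp: T_def[symmetric] top_unique ennreal_mult_eq_top_iff)
  ultimately have *: "cmod D / 2 * L \<le> T'" if "L \<ge> 0" for L
    using that by (simp flip: ennreal_mult)
  have "cmod D / 2 * ((T' + 1) * 2 / cmod D) \<le> T'"
    using D T' by (intro *) simp
  then show False using D by simp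
qed

section \<open>The Hardy space and its boundary pairing\<close>

lemma open_upper_half_plane: "open upper_half_plane"
  unfolding upper_half_plane_def by (rule open_halfspace_Im_gt)

lemma Complex_in_upper_half_plane [simp]: "Complex x y \<in> upper_half_plane \<longleftrightarrow> 0 < y"
  by (simp add: upper_half_plane_def)

lemma Hol_measurable_line:
  assumes "f \<in> Hol" "y > 0"
  shows "(\<lambda>x. f (Complex x y)) \<in> borel_measurable borel"
proof -
  have "continuous_on upper_half_plane f"
    using assms by (auto simp: Hol_def intro: holomorphic_on_imp_continuous_on)
  then have "continuous_on UNIV (\<lambda>x. f (Complex x y))"
    by (rule continuous_on_compose2) (use assms in \<open>auto intro!: continuous_intros\<close>)
  then show ?thesis
    by (rule borel_measurable_continuous_onI)
qed

lemma hardy2_Hol: "f \<in> hardy2 \<Longrightarrow> f \<in> Hol"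
  by (simp add: hardy2_def)

lemma hardy2E:
  assumes "f \<in> hardy2"
  obtains N where "N \<ge> 0"
    "\<And>y. y > 0 \<Longrightarrow> integrable lborel (\<lambda>x. (cmod (f (Complex x y)))\<^sup>2)"
    "\<And>y. y > 0 \<Longrightarrow> (\<integral>x. (cmod (f (Complex x y)))\<^sup>2 \<partial>lborel) \<le> N"
proof -
  let ?I = "\<lambda>y. \<integral>\<^sup>+ x. ennreal ((cmod (f (Complex x y)))\<^sup>2) \<partial>lborel"
  obtain N where N: "(SUP y\<in>{0::real<..}. ?I y) = ennreal N" "N \<ge> 0"
    using assms by (cases "SUP y\<in>{0::real<..}. ?I y") (auto simp: hardy2_def)
  have le: "?I y \<le> ennreal N" if "y > 0" for y
    unfolding N(1)[symmetric] by (rule SUP_upper) (use that in auto)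
  have int: "integrable lborel (\<lambda>x. (cmod (f (Complex x y)))\<^sup>2)" if "y > 0" for y
  proof (rule integrableI_nonneg)
    show "(\<lambda>x. (cmod (f (Complex x y)))\<^sup>2) \<in> borel_measurable lborel"
      using Hol_measurable_line[OF hardy2_Hol[OF assms] that] by measurable
    show "?I y < \<infinity>" using le[OF that] by (simp add: le_less_trans)
  qed auto
  have "(\<integral>x. (cmod (f (Complex x y)))\<^sup>2 \<partial>lborel) \<le> N" if "y > 0" for y
    using le[OF that] nn_integral_eq_integral[OF int[OF that]] N(2) by simp
  with int N(2) that show thesis by blast
qed

lemma integrable_one_over_1_plus_square: "integrable lborel (\<lambda>x::real. K / (x\<^sup>2 + 1))"
  using has_bochner_integral_poisson_kernel[of 1 0]
  by (auto simp: has_bochner_integral_iff intro!: integrable_mult_right[of K _ "\<lambda>x. 1 / (x\<^sup>2 + 1)", simplified])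

lemma decay_square_le: "u \<le> K / (1 + \<bar>x\<bar>) \<Longrightarrow> 0 \<le> u \<Longrightarrow> u\<^sup>2 \<le> K\<^sup>2 / (x\<^sup>2 + 1)" for u K x :: real
proof -
  assume *: "u \<le> K / (1 + \<bar>x\<bar>)" "0 \<le> u"
  have "u\<^sup>2 \<le> (K / (1 + \<bar>x\<bar>))\<^sup>2"
    using * by (intro power_mono)
  also have "\<dots> \<le> K\<^sup>2 / (x\<^sup>2 + 1)"
  proof -
    have "x\<^sup>2 + 1 \<le> (1 + \<bar>x\<bar>)\<^sup>2"
      by (simp add: power2_sum)
    then show ?thesis
      unfolding power_divide by (intro divide_left_mono) (auto intro!: mult_pos_pos add_nonneg_pos)
  qed
  finally show ?thesis .
qed

lemma hardy2I_decay:
  assumes "f \<in> Hol" and K: "\<And>z. z \<in> upper_half_plane \<Longrightarrow> cmod (f z) \<le> K / (1 + \<bar>Re z\<bar>)"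
  shows "f \<in> hardy2"
proof -
  have "(SUP y\<in>{0::real<..}. \<integral>\<^sup>+ x. ennreal ((cmod (f (Complex x y)))\<^sup>2) \<partial>lborel)
      \<le> (\<integral>\<^sup>+x. ennreal (K\<^sup>2 / (x\<^sup>2 + 1)) \<partial>lborel)"
    using K[of "Complex _ _"] by (intro SUP_least nn_integral_mono ennreal_leI decay_square_le) auto
  also have "\<dots> < \<infinity>"
    using nn_integral_eq_integral[OF integrable_one_over_1_plus_square[of "K\<^sup>2"]] by simp
  finally show ?thesis using assms(1) by (simp add: hardy2_def)
qed

text \<open>
  Functions whose boundary behaviour is controlled by dominated convergence. The kernels and
  model space elements that are paired with arbitrary Hardy functions below are all of this kind, and
  pairing with such a function has a limit at the boundary.
\<close>

definition tame :: "(complex \<Rightarrow> complex) \<Rightarrow> bool" where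
  "tame g \<longleftrightarrow> g \<in> Hol \<and> (\<exists>K. \<forall>z\<in>upper_half_plane. cmod (g z) \<le> K / (1 + \<bar>Re z\<bar>)) \<and>
     (AE x in lborel. \<exists>l. ((\<lambda>y. g (Complex x y)) \<longlongrightarrow> l) (at_right 0))"

lemma tame_hardy2: "tame g \<Longrightarrow> g \<in> hardy2"
  unfolding tame_def by (blast intro: hardy2I_decay)

lemma dominated_L2_null:
  fixes h :: "nat \<Rightarrow> real \<Rightarrow> complex"
  assumes [measurable]: "\<And>n. h n \<in> borel_measurable borel"
    and K: "\<And>n x. cmod (h n x) \<le> K / (1 + \<bar>x\<bar>)"
    and lim: "AE x in lborel. (\<lambda>n. h n x) \<longlonglongrightarrow> 0"
  shows "(\<lambda>n. \<integral>x. (cmod (h n x))\<^sup>2 \<partial>lborel) \<longlonglongrightarrow> 0"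
proof -
  have "(\<lambda>n. \<integral>x. (cmod (h n x))\<^sup>2 \<partial>lborel) \<longlonglongrightarrow> (\<integral>x. 0 \<partial>(lborel::real measure))"
  proof (rule integral_dominated_convergence[where w = "\<lambda>x. K\<^sup>2 / (x\<^sup>2 + 1)"])
    show "AE x in lborel. (\<lambda>n. (cmod (h n x))\<^sup>2) \<longlonglongrightarrow> 0"
      using lim by eventually_elim (auto intro!: tendsto_eq_intros simp: tendsto_norm_zero_iff)
    show "AE x in lborel. norm ((cmod (h n x))\<^sup>2) \<le> K\<^sup>2 / (x\<^sup>2 + 1)" for n
      using K by (auto intro!: decay_square_le)
  qed (auto intro: integrable_one_over_1_plus_square)
  then show ?thesis by simp
qed

lemma norm_diff_le_double:
  "cmod a \<le> K / c \<Longrightarrow> cmod b \<le> K / c \<Longrightarrow> cmod (a - b) \<le> 2 * K / c"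
  using norm_triangle_ineq4[of a b] by simp

text \<open>
  By dominated convergence along two sequences of heights that would violate the claim.
\<close>

lemma tame_L2_Cauchy:
  assumes g: "tame g" and "\<epsilon> > 0"
  shows "\<exists>\<delta>>0. \<forall>s t. 0 < s \<and> s < \<delta> \<and> 0 < t \<and> t < \<delta> \<longrightarrow>
      (\<integral>x. (cmod (g (Complex x s) - g (Complex x t)))\<^sup>2 \<partial>lborel) < \<epsilon>"
proof (rule ccontr)
  assume neg: "\<not> ?thesis"
  define Q where "Q n s t \<longleftrightarrow> 0 < s \<and> s < 1 / real (Suc n) \<and> 0 < t \<and> t < 1 / real (Suc n) \<and>
      (\<integral>x. (cmod (g (Complex x s) - g (Complex x t)))\<^sup>2 \<partial>lborel) \<ge> \<epsilon>" for n s t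
  have "\<exists>s t. Q n s t" for n
  proof -
    have "1 / real (Suc n) > 0" by simp
    with neg show ?thesis unfolding Q_def not_ex not_all not_imp not_le[symmetric] by blast
  qed
  then obtain s t where Q: "\<And>n. Q n (s n) (t n)"
    by metis
  have st: "0 < s n" "s n < 1 / real (Suc n)" "0 < t n" "t n < 1 / real (Suc n)"
      "(\<integral>x. (cmod (g (Complex x (s n)) - g (Complex x (t n))))\<^sup>2 \<partial>lborel) \<ge> \<epsilon>" for n
    using Q[of n] by (simp_all add: Q_def)
  have st0: "s n \<noteq> 0" "t n \<noteq> 0" for n
    using st(1,3)[of n] by auto
  have lim: "filterlim s (at_right 0) sequentially" "filterlim t (at_right 0) sequentially"
    using st st0 unfolding filterlim_at
    by (auto intro!: tendsto_sandwich[OF _ _ tendsto_const LIMSEQ_Suc[OF lim_1_over_n]] always_eventually less_imp_le simp del: of_nat_Suc)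
  obtain K where K: "\<And>z. z \<in> upper_half_plane \<Longrightarrow> cmod (g z) \<le> K / (1 + \<bar>Re z\<bar>)"
    using g by (auto simp: tame_def)
  have "(\<lambda>n. \<integral>x. (cmod (g (Complex x (s n)) - g (Complex x (t n))))\<^sup>2 \<partial>lborel) \<longlonglongrightarrow> 0"
  proof (rule dominated_L2_null[where K = "2 * K"])
    show "(\<lambda>x. g (Complex x (s n)) - g (Complex x (t n))) \<in> borel_measurable borel" for n
      using g st by (auto simp: tame_def intro!: borel_measurable_diff Hol_measurable_line)
    show "cmod (g (Complex x (s n)) - g (Complex x (t n))) \<le> 2 * K / (1 + \<bar>x\<bar>)" for n x
      using K[of "Complex x (s n)"] K[of "Complex x (t n)"] st(1,3)[of n] by (intro norm_diff_le_double) simp_all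
    have "AE x in lborel. \<exists>l. ((\<lambda>y. g (Complex x y)) \<longlongrightarrow> l) (at_right 0)"
      using g by (simp add: tame_def)
    then show "AE x in lborel. (\<lambda>n. g (Complex x (s n)) - g (Complex x (t n))) \<longlonglongrightarrow> 0"
    proof eventually_elim
      case (elim x)
      then obtain l where l: "((\<lambda>y. g (Complex x y)) \<longlongrightarrow> l) (at_right 0)" ..
      show ?case
        using tendsto_diff[OF filterlim_compose[OF l lim(1)] filterlim_compose[OF l lim(2)]] by simp
    qed
  qed
  then have "\<epsilon> \<le> 0"
    by (rule LIMSEQ_le_const) (use st(5) in auto)
  with \<open>\<epsilon> > 0\<close> show False by simp
qed

lemma borel_measurable_cnj [measurable]: "cnj \<in> borel_measurable borel"
  by (intro borel_measurable_continuous_onI continuous_intros)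

lemma hardy2_pairing:
  assumes "f \<in> hardy2" "g \<in> hardy2" "s > 0" "t > 0"
  shows "integrable lborel (\<lambda>x. f (Complex x s) * cnj (g (Complex x t)))"
    and "integrable lborel (\<lambda>x. f (Complex x s) * g (Complex x t))"
    and "(\<integral>x. cmod (f (Complex x s) * cnj (g (Complex x t))) \<partial>lborel)
     \<le> sqrt (\<integral>x. (cmod (f (Complex x s)))\<^sup>2 \<partial>lborel) * sqrt (\<integral>x. (cmod (g (Complex x t)))\<^sup>2 \<partial>lborel)"
proof -
  obtain N where f: "\<And>y. y > 0 \<Longrightarrow> integrable lborel (\<lambda>x. (cmod (f (Complex x y)))\<^sup>2)"
    using assms(1) hardy2E by metis
  obtain N' where g: "\<And>y. y > 0 \<Longrightarrow> integrable lborel (\<lambda>x. (cmod (g (Complex x y)))\<^sup>2)"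
    using assms(2) hardy2E by metis
  have [measurable]: "(\<lambda>x. f (Complex x s)) \<in> borel_measurable borel" "(\<lambda>x. g (Complex x t)) \<in> borel_measurable borel"
    using assms hardy2_Hol by (auto intro: Hol_measurable_line)
  show "integrable lborel (\<lambda>x. f (Complex x s) * cnj (g (Complex x t)))"
    "(\<integral>x. cmod (f (Complex x s) * cnj (g (Complex x t))) \<partial>lborel)
     \<le> sqrt (\<integral>x. (cmod (f (Complex x s)))\<^sup>2 \<partial>lborel) * sqrt (\<integral>x. (cmod (g (Complex x t)))\<^sup>2 \<partial>lborel)"
    using Cauchy_Schwarz_integral[of "\<lambda>x. f (Complex x s)" lborel "\<lambda>x. cnj (g (Complex x t))"] assms f g
 by simp_all
  show "integrable lborel (\<lambda>x. f (Complex x s) * g (Complex x t))"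
    using Cauchy_Schwarz_integral[of "\<lambda>x. f (Complex x s)" lborel "\<lambda>x. (g (Complex x t))"] assms f g by simp_all
qed

text \<open>
  The integrand is the value at height \<open>s\<close> of \<open>f z * cnj (g (cnj z + \<i> * c))\<close>, which is
  holomorphic in the strip of height \<open>c\<close>, so the line of integration may be moved.
\<close>

lemma hardy2_pairing_shift:
  assumes f: "f \<in> hardy2" and g: "g \<in> hardy2" and st: "0 < s" "s \<le> t" "t < c"
  shows "(\<integral>x. f (Complex x s) * cnj (g (Complex x (c - s))) \<partial>lborel)
       = (\<integral>x. f (Complex x t) * cnj (g (Complex x (c - t))) \<partial>lborel)"
proof -
  define H where "H z = f z * cnj (g (cnj z + \<i> * of_real c))" for z
  have H: "H (Complex x y) = f (Complex x y) * cnj (g (Complex x (c - y)))" for x y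
  proof -
    have "cnj (Complex x y) + \<i> * of_real c = Complex x (c - y)" by (simp add: complex_eq_iff)
    then show ?thesis by (simp add: H_def)
  qed
  obtain N1 where N1: "N1 \<ge> 0" "\<And>y. y > 0 \<Longrightarrow> (\<integral>x. (cmod (f (Complex x y)))\<^sup>2 \<partial>lborel) \<le> N1"
    using f hardy2E by metis
  obtain N2 where N2: "N2 \<ge> 0" "\<And>y. y > 0 \<Longrightarrow> (\<integral>x. (cmod (g (Complex x y)))\<^sup>2 \<partial>lborel) \<le> N2"
    using g hardy2E by metis
  have "(\<integral>x. H (Complex x s) \<partial>lborel) = (\<integral>x. H (Complex x t) \<partial>lborel)"
  proof (rule line_integral_shift[where a = 0 and b = c and r = 0 and C = "sqrt N1 * sqrt N2"])
    let ?S = "{z. 0 < Im z \<and> Im z < c}"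
    have hf: "f holomorphic_on upper_half_plane" "g holomorphic_on upper_half_plane"
      using f g hardy2_Hol by (auto simp: Hol_def)
    have opS: "open ?S"
      unfolding Collect_conj_eq by (intro open_Int open_halfspace_Im_gt open_halfspace_Im_lt)
    have "(\<lambda>z. g (z + \<i> * of_real c)) holomorphic_on cnj ` ?S"
      by (rule holomorphic_on_compose[OF _ holomorphic_on_subset[OF hf(2)], unfolded o_def])
         (auto simp: upper_half_plane_def intro!: holomorphic_intros)
    then have "cnj \<circ> (\<lambda>z. g (z + \<i> * of_real c)) \<circ> cnj holomorphic_on ?S"
      using opS by (rule holomorphic_on_compose_cnj_cnj)
    moreover have "f holomorphic_on ?S"
      using hf(1) by (rule holomorphic_on_subset) (auto simp: upper_half_plane_def)
    ultimately show "H holomorphic_on ?S"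
      unfolding H_def by (auto simp: o_def intro!: holomorphic_intros)
    show "integrable lborel (\<lambda>x. H (Complex x s))" "integrable lborel (\<lambda>x. H (Complex x t))"
      unfolding H using st by (intro hardy2_pairing f g; simp)+
    show "(\<integral>\<^sup>+x. ennreal (cmod (H (Complex x y))) * indicator {x. 0 \<le> \<bar>x\<bar>} x \<partial>lborel) \<le> ennreal (sqrt N1 * sqrt N2)"
      if "s \<le> y" "y \<le> t" for y
    proof -
      have y: "0 < y" "0 < c - y" using that st by auto
      have "(\<integral>\<^sup>+x. ennreal (cmod (H (Complex x y))) * indicator {x. 0 \<le> \<bar>x\<bar>} x \<partial>lborel)
        = ennreal (\<integral>x. cmod (H (Complex x y)) \<partial>lborel)"
        using nn_integral_eq_integral[OF integrable_norm[OF hardy2_pairing(1)[OF f g y]]] by (simp add: H)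
      also have "\<dots> \<le> ennreal (sqrt N1 * sqrt N2)"
        unfolding H using N1 N2 y by (intro ennreal_leI order_trans[OF hardy2_pairing(3)[OF f g y]] mult_mono) auto
      finally show ?thesis .
    qed
  qed (use st in auto)
  then show ?thesis by (simp add: H)
qed

text \<open>
  Moving the line for \<open>f\<close> from the height \<open>y\<close> down to \<open>y' < y\<close> moves the line for \<open>g\<close> up to
  \<open>2 * y - y'\<close>, and both pairings now involve the same function of \<open>f\<close>. Their difference is
  small as soon as \<open>g\<close> is an L2 Cauchy family at the boundary.
\<close>

lemma hardy2_tame_pairing_converges:
  assumes f: "f \<in> hardy2" and g: "tame g"
  shows "\<exists>L. ((\<lambda>y. \<integral>x. f (Complex x y) * cnj (g (Complex x y)) \<partial>lborel) \<longlongrightarrow> L) (at_right 0)"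
proof -
  let ?I = "\<lambda>y. \<integral>x. f (Complex x y) * cnj (g (Complex x y)) \<partial>lborel"
  have gh: "g \<in> hardy2" using g by (rule tame_hardy2)
  obtain N where N: "N \<ge> 0" "\<And>y. y > 0 \<Longrightarrow> integrable lborel (\<lambda>x. (cmod (f (Complex x y)))\<^sup>2)"
    "\<And>y. y > 0 \<Longrightarrow> (\<integral>x. (cmod (f (Complex x y)))\<^sup>2 \<partial>lborel) \<le> N"
    using f hardy2E by metis
  have "cauchy_filter (filtermap ?I (at_right 0))"
    unfolding cauchy_filter_metric_filtermap
  proof (intro allI impI)
    fix e :: real assume e: "e > 0"
    \<comment> \<open>The 1 is there because \<open>N\<close> may be 0.\<close>
    define \<epsilon> where "\<epsilon> = e\<^sup>2 / (N + 1)"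
    have "\<epsilon> > 0" using e N by (simp add: \<epsilon>_def)
    from tame_L2_Cauchy[OF g this] obtain \<delta> where \<delta>: "\<delta> > 0"
      "\<And>s t. 0 < s \<Longrightarrow> s < \<delta> \<Longrightarrow> 0 < t \<Longrightarrow> t < \<delta> \<Longrightarrow>
        (\<integral>x. (cmod (g (Complex x s) - g (Complex x t)))\<^sup>2 \<partial>lborel) < \<epsilon>" by blast
    have le: "dist (?I y') (?I y) < e" if y: "0 < y'" "y' \<le> y" "y < \<delta> / 2" for y y'
    proof -
      define t where "t = 2 * y - y'"
      have t: "0 < t" "t < \<delta>" "y' < \<delta>" using y by (auto simp: t_def)
      have "?I y = (\<integral>x. f (Complex x y') * cnj (g (Complex x t)) \<partial>lborel)"
        using hardy2_pairing_shift[OF f gh, of y' y "2 * y"] y by (simp add: t_def)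
      then have "?I y' - ?I y = (\<integral>x. f (Complex x y') * cnj (g (Complex x y')) - f (Complex x y') * cnj (g (Complex x t)) \<partial>lborel)"
        using y t by (subst Bochner_Integration.integral_diff) (auto intro!: hardy2_pairing(1) f gh)
      also have "\<dots> = (\<integral>x. f (Complex x y') * cnj (g (Complex x y') - g (Complex x t)) \<partial>lborel)"
        by (simp add: algebra_simps)
      also have "cmod \<dots> \<le> (\<integral>x. cmod (f (Complex x y') * cnj (g (Complex x y') - g (Complex x t))) \<partial>lborel)"
        by (rule integral_norm_bound)
      also have "\<dots> \<le> sqrt (\<integral>x. (cmod (f (Complex x y')))\<^sup>2 \<partial>lborel) *
          sqrt (\<integral>x. (cmod (cnj (g (Complex x y') - g (Complex x t))))\<^sup>2 \<partial>lborel)"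
      proof (rule Cauchy_Schwarz_integral(2))
        have [measurable]: "(\<lambda>x. g (Complex x y')) \<in> borel_measurable borel" "(\<lambda>x. g (Complex x t)) \<in> borel_measurable borel"
          "(\<lambda>x. f (Complex x y')) \<in> borel_measurable borel"
          using f gh y t hardy2_Hol by (auto intro: Hol_measurable_line)
        show "(\<lambda>x. f (Complex x y')) \<in> borel_measurable lborel"
          "(\<lambda>x. cnj (g (Complex x y') - g (Complex x t))) \<in> borel_measurable lborel"
          by measurable
        show "integrable lborel (\<lambda>x. (cmod (f (Complex x y')))\<^sup>2)" using N y by simp
        obtain K where K: "\<And>z. z \<in> upper_half_plane \<Longrightarrow> cmod (g z) \<le> K / (1 + \<bar>Re z\<bar>)"
          using g by (auto simp: tame_def)
        show "integrable lborel (\<lambda>x. (cmod (cnj (g (Complex x y') - g (Complex x t))))\<^sup>2)"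
        proof (rule Bochner_Integration.integrable_bound[OF integrable_one_over_1_plus_square[of "(2 * K)\<^sup>2"]])
          have "cmod (g (Complex x y') - g (Complex x t)) \<le> 2 * K / (1 + \<bar>x\<bar>)" for x
            using K[of "Complex x y'"] K[of "Complex x t"] y t by (intro norm_diff_le_double) simp_all
          then have "(cmod (g (Complex x y') - g (Complex x t)))\<^sup>2 \<le> (2 * K)\<^sup>2 / (x\<^sup>2 + 1)" for x
            by (rule decay_square_le) simp
          then show "AE x in lborel. norm ((cmod (cnj (g (Complex x y') - g (Complex x t))))\<^sup>2) \<le> norm ((2 * K)\<^sup>2 / (x\<^sup>2 + 1))"
            by (intro AE_I2) (simp del: complex_cnj_diff add: complex_mod_cnj)
        qed measurable
      qed
      also have "\<dots> \<le> sqrt (N + 1) * sqrt (\<integral>x. (cmod (g (Complex x y') - g (Complex x t)))\<^sup>2 \<partial>lborel)"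
        using N(3)[of y'] y by (simp del: complex_cnj_diff add: complex_mod_cnj mult_right_mono)
      also have "\<dots> < sqrt (N + 1) * sqrt \<epsilon>"
        using \<delta>(2)[of y' t] y t N by simp
      also have "\<dots> = e"
        using N e by (simp add: \<epsilon>_def flip: real_sqrt_mult)
      finally show ?thesis by (simp add: dist_norm)
    qed
    show "\<exists>P. eventually P (at_right 0) \<and> (\<forall>x y. P x \<and> P y \<longrightarrow> dist (?I x) (?I y) < e)"
    proof (intro exI conjI)
      show "\<forall>\<^sub>F y in at_right 0. 0 < y \<and> y < \<delta> / 2"
        using \<delta> by (intro eventually_at_right_real[THEN eventually_mono, of 0 "\<delta>/2"]) auto
      show "\<forall>x y. (0 < x \<and> x < \<delta> / 2) \<and> (0 < y \<and> y < \<delta> / 2) \<longrightarrow> dist (?I x) (?I y) < e"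
      proof (intro allI impI)
        fix x y assume *: "(0 < x \<and> x < \<delta> / 2) \<and> (0 < y \<and> y < \<delta> / 2)"
        show "dist (?I x) (?I y) < e"
        proof (cases "x \<le> y")
          case True with le[of x y] * show ?thesis by blast
        next
          case False
          then have "dist (?I y) (?I x) < e" using * by (intro le) auto
          then show ?thesis by (subst dist_commute)
        qed
      qed
    qed
  qed
  then have "\<exists>L. filtermap ?I (at_right 0) \<le> nhds L"
    by (rule cauchy_filter_complete_converges[OF _ complete_UNIV])
      (auto simp: filtermap_bot_iff trivial_limit_at_right_real)
  then show ?thesis
    by (simp add: filterlim_def)
qed

section \<open>Cauchy integrals of Hardy functions\<close>

lemma integrable_Cauchy_kernel_square:
  assumes "y \<noteq> Im w"
  shows "integrable lborel (\<lambda>x. (cmod (1 / (Complex x y - w)))\<^sup>2)"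
    and "(\<integral>x. (cmod (1 / (Complex x y - w)))\<^sup>2 \<partial>lborel) = pi / \<bar>y - Im w\<bar>"
proof -
  have "(cmod (1 / (Complex x y - w)))\<^sup>2 = 1 / ((x - Re w)\<^sup>2 + \<bar>y - Im w\<bar>\<^sup>2)" for x
    by (simp add: norm_divide power_divide cmod_power2)
  then show "integrable lborel (\<lambda>x. (cmod (1 / (Complex x y - w)))\<^sup>2)"
    "(\<integral>x. (cmod (1 / (Complex x y - w)))\<^sup>2 \<partial>lborel) = pi / \<bar>y - Im w\<bar>"
    using has_bochner_integral_poisson_kernel[of "\<bar>y - Im w\<bar>" "Re w"] assms
    by (simp_all add: has_bochner_integral_iff)
qed

lemma measurable_Cauchy_kernel [measurable]:
  "(\<lambda>x. 1 / (Complex x y - w)) \<in> borel_measurable borel"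
proof -
  have "(\<lambda>x. Complex x y) \<in> borel_measurable borel"
    by (intro borel_measurable_continuous_onI continuous_intros)
  then show ?thesis by measurable
qed

lemma hardy2_Cauchy_kernel:
  assumes f: "f \<in> hardy2" and N: "\<And>y. y > 0 \<Longrightarrow> (\<integral>x. (cmod (f (Complex x y)))\<^sup>2 \<partial>lborel) \<le> N"
    and y: "y > 0" "y \<noteq> Im w"
  shows "integrable lborel (\<lambda>x. f (Complex x y) * (1 / (Complex x y - w)))"
    and "cmod (\<integral>x. f (Complex x y) * (1 / (Complex x y - w)) \<partial>lborel) \<le> sqrt N * sqrt (pi / \<bar>y - Im w\<bar>)"
proof -
  have fi: "integrable lborel (\<lambda>x. (cmod (f (Complex x y)))\<^sup>2)"
    using f y hardy2E by metis
  have [measurable]: "(\<lambda>x. f (Complex x y)) \<in> borel_measurable borel"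
    using f y hardy2_Hol Hol_measurable_line by blast
  note CS = Cauchy_Schwarz_integral[of "\<lambda>x. f (Complex x y)" lborel "\<lambda>x. 1 / (Complex x y - w)",
      OF _ _ fi integrable_Cauchy_kernel_square(1)[OF y(2)]]
  show "integrable lborel (\<lambda>x. f (Complex x y) * (1 / (Complex x y - w)))"
    by (rule CS) measurable
  have "cmod (\<integral>x. f (Complex x y) * (1 / (Complex x y - w)) \<partial>lborel)
     \<le> (\<integral>x. cmod (f (Complex x y) * (1 / (Complex x y - w))) \<partial>lborel)"
    by (rule integral_norm_bound)
  also have "\<dots> \<le> sqrt (\<integral>x. (cmod (f (Complex x y)))\<^sup>2 \<partial>lborel) * sqrt (pi / \<bar>y - Im w\<bar>)"
    unfolding integrable_Cauchy_kernel_square(2)[OF y(2), symmetric]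
    by (rule CS) measurable
  also have "\<dots> \<le> sqrt N * sqrt (pi / \<bar>y - Im w\<bar>)"
    using N[OF y(1)] by (intro mult_right_mono) auto
  finally show "cmod (\<integral>x. f (Complex x y) * (1 / (Complex x y - w)) \<partial>lborel) \<le> sqrt N * sqrt (pi / \<bar>y - Im w\<bar>)" .
qed

lemma Cauchy_kernel_product:
  assumes "y \<noteq> Im w" "y \<noteq> Im p"
  shows "integrable lborel (\<lambda>x. 1 / (Complex x y - p) * (1 / (Complex x y - w)))"
    and "cmod (\<integral>x. 1 / (Complex x y - p) * (1 / (Complex x y - w)) \<partial>lborel)
       \<le> sqrt (pi / \<bar>y - Im p\<bar>) * sqrt (pi / \<bar>y - Im w\<bar>)"
proof -
  note CS = Cauchy_Schwarz_integral[of "\<lambda>x. 1 / (Complex x y - p)" lborel "\<lambda>x. 1 / (Complex x y - w)",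
      OF _ _ integrable_Cauchy_kernel_square(1)[OF assms(2)] integrable_Cauchy_kernel_square(1)[OF assms(1)]]
  show "integrable lborel (\<lambda>x. 1 / (Complex x y - p) * (1 / (Complex x y - w)))"
    by (rule CS) measurable
  have "cmod (\<integral>x. 1 / (Complex x y - p) * (1 / (Complex x y - w)) \<partial>lborel)
     \<le> (\<integral>x. cmod (1 / (Complex x y - p) * (1 / (Complex x y - w))) \<partial>lborel)"
    by (rule integral_norm_bound)
  also have "\<dots> \<le> sqrt (pi / \<bar>y - Im p\<bar>) * sqrt (pi / \<bar>y - Im w\<bar>)"
    unfolding integrable_Cauchy_kernel_square(2)[OF assms(1), symmetric] integrable_Cauchy_kernel_square(2)[OF assms(2), symmetric]
    by (rule CS) measurable
  finally show "cmod (\<integral>x. 1 / (Complex x y - p) * (1 / (Complex x y - w)) \<partial>lborel)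
       \<le> sqrt (pi / \<bar>y - Im p\<bar>) * sqrt (pi / \<bar>y - Im w\<bar>)" .
qed

text \<open>
  Let \<open>p\<close> be the mirror image of \<open>w\<close> in the line at height \<open>s\<close>. Subtracting from \<open>f\<close> the multiple of
  \<open>1 / (z - p)\<close> that agrees with \<open>f\<close> at \<open>w\<close> removes the pole of the Cauchy integrand without
  destroying integrability. The integral of the difference does not depend on the height of the
  line and tends to 0 as the line moves up, hence it vanishes. The subtracted term is a Poisson kernel on
  the line at height \<open>s\<close>.
\<close>

lemma hardy2_Cauchy_formula:
  assumes f: "f \<in> hardy2" and s: "0 < s" "s < Im w"
  shows "(\<integral>x. f (Complex x s) * (1 / (Complex x s - w)) \<partial>lborel) = 2 * pi * \<i> * f w"
proof -
  define p where "p = cnj w + 2 * \<i> * of_real s"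
  \<comment> \<open>The point \<open>p\<close> may lie in the upper half-plane, so the strip has to start above it.\<close>
  define a0 where "a0 = max 0 (Im p)"
  have Imp: "Im p = 2 * s - Im w" and Rep: "Re p = Re w" by (simp_all add: p_def)
  have a0: "0 \<le> a0" "a0 < s" "Im p \<le> a0" using s by (auto simp: a0_def Imp)
  have wp: "w \<noteq> p" using Imp s by auto
  define C0 where "C0 = f w * (w - p)"
  define F where "F z = f z - C0 / (z - p)" for z
  have Fw: "F w = 0" using wp by (simp add: F_def C0_def)
  define H where "H z = (if z = w then deriv F w else (F z - F w) / (z - w))" for z
  obtain N where N: "N \<ge> 0" "\<And>y. y > 0 \<Longrightarrow> integrable lborel (\<lambda>x. (cmod (f (Complex x y)))\<^sup>2)"
    "\<And>y. y > 0 \<Longrightarrow> (\<integral>x. (cmod (f (Complex x y)))\<^sup>2 \<partial>lborel) \<le> N"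
    using f hardy2E by metis
  have Hline: "H (Complex x y) = f (Complex x y) * (1 / (Complex x y - w))
      - C0 * (1 / (Complex x y - p) * (1 / (Complex x y - w)))" if "y \<noteq> Im w" for x y
  proof -
    have "Complex x y \<noteq> w" using that by auto
    then have "H (Complex x y) = F (Complex x y) / (Complex x y - w)"
      by (simp add: H_def Fw)
    also have "\<dots> = f (Complex x y) / (Complex x y - w) - C0 / (Complex x y - p) / (Complex x y - w)"
      by (simp only: F_def diff_divide_distrib)
    finally show ?thesis by simp
  qed
  have intH: "integrable lborel (\<lambda>x. H (Complex x y))" if "0 < y" "y \<noteq> Im w" "y \<noteq> Im p" for y
    unfolding Hline[OF that(2)] using that
    by (intro Bochner_Integration.integrable_diff integrable_mult_right hardy2_Cauchy_kernel[OF f N(3)] Cauchy_kernel_product)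
  have int_H: "(\<integral>x. H (Complex x y) \<partial>lborel) = (\<integral>x. f (Complex x y) * (1 / (Complex x y - w)) \<partial>lborel)
          - C0 * (\<integral>x. 1 / (Complex x y - p) * (1 / (Complex x y - w)) \<partial>lborel)"
    if "0 < y" "y \<noteq> Im w" "y \<noteq> Im p" for y
    using Bochner_Integration.integral_diff[OF hardy2_Cauchy_kernel(1)[OF f N(3) that(1,2)]
        integrable_mult_right[OF Cauchy_kernel_product(1)[OF that(2,3)], of C0]]
    by (simp only: Hline[OF that(2)] integral_mult_right_zero)
  have shift: "(\<integral>x. H (Complex x s) \<partial>lborel) = (\<integral>x. H (Complex x t) \<partial>lborel)" if t: "t > Im w" for t
  proof (rule line_integral_shift[where a = a0 and b = "t + 1" and r = "\<bar>Re w\<bar> + 1"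
      and C = "N + (2 + 2 * cmod C0) * pi"])
    let ?S = "{z. a0 < Im z \<and> Im z < t + 1}"
    have opS: "open ?S"
      unfolding Collect_conj_eq by (intro open_Int open_halfspace_Im_gt open_halfspace_Im_lt)
    have "F holomorphic_on ?S"
      unfolding F_def
    proof (intro holomorphic_intros)
      show "f holomorphic_on ?S"
        using hardy2_Hol[OF f] a0 by (auto simp: Hol_def upper_half_plane_def intro: holomorphic_on_subset)
      show "z - p \<noteq> 0" if "z \<in> ?S" for z using that a0 by auto
    qed
    then show "H holomorphic_on ?S"
      unfolding H_def using opS by (rule pole_lemma_open)
    show "integrable lborel (\<lambda>x. H (Complex x s))" "integrable lborel (\<lambda>x. H (Complex x t))"
      by (rule intH; use s t in \<open>simp add: Imp\<close>)+
    show "(\<integral>\<^sup>+x. ennreal (cmod (H (Complex x y))) * indicator {x. \<bar>Re w\<bar> + 1 \<le> \<bar>x\<bar>} x \<partial>lborel)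
        \<le> ennreal (N + (2 + 2 * cmod C0) * pi)" if y: "s \<le> y" "y \<le> t" for y
    proof -
      have y0: "y > 0" using y s by simp
      let ?q = "\<lambda>x. 1 / ((x - Re w)\<^sup>2 + 1\<^sup>2)"
      note q = has_bochner_integral_poisson_kernel[of 1 "Re w"]
      let ?m = "\<lambda>x. (cmod (f (Complex x y)))\<^sup>2 + (2 + 2 * cmod C0) * ?q x"
      have bound: "cmod (H (Complex x y)) \<le> ?m x" if x: "\<bar>Re w\<bar> + 1 \<le> \<bar>x\<bar>" for x
      proof -
        define d where "d = \<bar>x - Re w\<bar>"
        have d: "d \<ge> 1" using x by (simp add: d_def)
        have dw: "d \<le> cmod (Complex x y - w)"
          unfolding d_def using abs_Re_le_cmod[of "Complex x y - w"] by simp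
        have dp: "d \<le> cmod (Complex x y - p)"
          unfolding d_def using abs_Re_le_cmod[of "Complex x y - p"] by (simp add: Rep)
        have kw: "cmod (1 / (Complex x y - w)) \<le> 1 / d" and kp: "cmod (1 / (Complex x y - p)) \<le> 1 / d"
          using dw dp d by (auto simp: norm_divide intro!: divide_left_mono mult_pos_pos)
        have dd: "1 / d * (1 / d) \<le> 2 * ?q x"
        proof -
          have "1 \<le> d\<^sup>2" using d by simp
          then have "d\<^sup>2 + 1 \<le> 2 * d\<^sup>2" by simp
          then have "2 / (2 * d\<^sup>2) \<le> 2 / (d\<^sup>2 + 1)" using d
            by (intro divide_left_mono) (auto intro!: mult_pos_pos add_pos_pos)
          moreover have "(x - Re w)\<^sup>2 = d\<^sup>2" by (simp add: d_def)
          ultimately show ?thesis by (simp add: power2_eq_square)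
        qed
        have ne: "Complex x y \<noteq> w" using dw d by auto
        have "H (Complex x y) = f (Complex x y) * (1 / (Complex x y - w))
            - C0 * (1 / (Complex x y - p) * (1 / (Complex x y - w)))"
        proof -
          have "H (Complex x y) = F (Complex x y) / (Complex x y - w)" using ne by (simp add: H_def Fw)
          also have "\<dots> = f (Complex x y) / (Complex x y - w) - C0 / (Complex x y - p) / (Complex x y - w)"
      by (simp only: F_def diff_divide_distrib)
    finally show ?thesis by simp
        qed
        then have "cmod (H (Complex x y)) \<le> cmod (f (Complex x y)) * cmod (1 / (Complex x y - w))
            + cmod C0 * (cmod (1 / (Complex x y - p)) * cmod (1 / (Complex x y - w)))"
          by (simp only: norm_mult[symmetric] norm_triangle_ineq4)
        also have "\<dots> \<le> cmod (f (Complex x y)) * (1 / d) + cmod C0 * (1 / d * (1 / d))"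
          using kw kp d by (intro add_mono mult_mono mult_nonneg_nonneg) auto
        also have "cmod (f (Complex x y)) * (1 / d) \<le> (cmod (f (Complex x y)))\<^sup>2 + 1 / d * (1 / d)"
        proof -
          have "0 \<le> cmod (f (Complex x y)) * (1 / d)" using d by simp
          then show ?thesis
            using sum_squares_bound[of "cmod (f (Complex x y))" "1 / d"] unfolding power2_eq_square by linarith
        qed
        also have "(cmod (f (Complex x y)))\<^sup>2 + 1 / d * (1 / d) + cmod C0 * (1 / d * (1 / d))
            = (cmod (f (Complex x y)))\<^sup>2 + (1 + cmod C0) * (1 / d * (1 / d))"
          by (simp only: distrib_right mult_1_left add.assoc)
        also have "\<dots> \<le> (cmod (f (Complex x y)))\<^sup>2 + (1 + cmod C0) * (2 * ?q x)"
          by (intro add_left_mono mult_left_mono dd) simp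
        also have "\<dots> = ?m x"
        proof -
          have "(1 + c) * (2 * r) = (2 + 2 * c) * r" for c r :: real by (simp add: algebra_simps)
          then show ?thesis by (simp only:)
        qed
        finally show ?thesis by simp
      qed
      have mi: "has_bochner_integral lborel ?m ((\<integral>x. (cmod (f (Complex x y)))\<^sup>2 \<partial>lborel) + (2 + 2 * cmod C0) * (pi / 1))"
        using q N(2)[OF y0] by (intro has_bochner_integral_add has_bochner_integral_mult_right)
          (auto simp: has_bochner_integral_iff)
      have "(\<integral>\<^sup>+x. ennreal (cmod (H (Complex x y))) * indicator {x. \<bar>Re w\<bar> + 1 \<le> \<bar>x\<bar>} x \<partial>lborel)
          \<le> (\<integral>\<^sup>+x. ennreal (?m x) \<partial>lborel)"
      proof (intro nn_integral_mono)
        fix x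
        show "ennreal (cmod (H (Complex x y))) * indicator {x. \<bar>Re w\<bar> + 1 \<le> \<bar>x\<bar>} x \<le> ennreal (?m x)"
        proof (cases "\<bar>Re w\<bar> + 1 \<le> \<bar>x\<bar>")
          case True
          then have "indicator {x. \<bar>Re w\<bar> + 1 \<le> \<bar>x\<bar>} x = (1::ennreal)" by simp
          with ennreal_leI[OF bound[OF True]] show ?thesis by (simp only: mult_1_right)
        next
          case False
          then have "indicator {x. \<bar>Re w\<bar> + 1 \<le> \<bar>x\<bar>} x = (0::ennreal)" by simp
          then show ?thesis by (simp only: mult_zero_right zero_le)
        qed
      qed
      also have "\<dots> = ennreal (\<integral>x. ?m x \<partial>lborel)"
        using mi by (intro nn_integral_eq_integral) (auto simp: has_bochner_integral_iff)
      also have "\<dots> \<le> ennreal (N + (2 + 2 * cmod C0) * pi)"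
        using has_bochner_integral_integral_eq[OF mi] N(3)[OF y0] by (intro ennreal_leI) simp
      finally show ?thesis .
    qed
  qed (use a0 s t in auto)
  have "((\<lambda>t::real. cmod (\<integral>x. H (Complex x s) \<partial>lborel)) \<longlongrightarrow> 0) at_top"
  proof (rule Lim_null_comparison)
    show "\<forall>\<^sub>F t in at_top. norm (cmod (\<integral>x. H (Complex x s) \<partial>lborel))
       \<le> sqrt N * sqrt (pi / (t - Im w)) + cmod C0 * (sqrt (pi / (t - Im p)) * sqrt (pi / (t - Im w)))"
      using eventually_gt_at_top[of "Im w"]
    proof eventually_elim
      case (elim t)
      have t: "0 < t" "t \<noteq> Im w" "t \<noteq> Im p" "t > Im p" using elim s by (auto simp: Imp)
      have "cmod (\<integral>x. H (Complex x s) \<partial>lborel) \<le>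
          cmod (\<integral>x. f (Complex x t) * (1 / (Complex x t - w)) \<partial>lborel)
          + cmod C0 * cmod (\<integral>x. 1 / (Complex x t - p) * (1 / (Complex x t - w)) \<partial>lborel)"
        unfolding shift[OF elim] int_H[OF t(1-3)] by (simp only: norm_mult[symmetric] norm_triangle_ineq4)
      also have "\<dots> \<le> sqrt N * sqrt (pi / (t - Im w)) + cmod C0 * (sqrt (pi / (t - Im p)) * sqrt (pi / (t - Im w)))"
        using hardy2_Cauchy_kernel(2)[OF f N(3) t(1,2)] Cauchy_kernel_product(2)[OF t(2,3)] elim t
        by (intro add_mono mult_left_mono) simp_all
      finally show ?case by simp
    qed
    have "((\<lambda>t. sqrt (pi / (t - c))) \<longlongrightarrow> 0) at_top" for c
    proof -
      have "((\<lambda>t. pi / (t - c)) \<longlongrightarrow> 0) at_top"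
        by real_asymp
      from tendsto_real_sqrt[OF this] show ?thesis by simp
    qed
    then show "((\<lambda>t. sqrt N * sqrt (pi / (t - Im w)) + cmod C0 * (sqrt (pi / (t - Im p)) * sqrt (pi / (t - Im w)))) \<longlongrightarrow> 0) at_top"
      by (auto intro!: tendsto_add_zero tendsto_mult_right_zero tendsto_mult_zero)
  qed
  then have "(\<integral>x. H (Complex x s) \<partial>lborel) = 0"
    by (simp add: tendsto_const_iff)
  moreover note int_H[of s]
  moreover have "(\<integral>x. 1 / (Complex x s - p) * (1 / (Complex x s - w)) \<partial>lborel) = of_real (pi / (Im w - s))"
  proof -
    have "1 / (Complex x s - p) * (1 / (Complex x s - w)) = of_real (1 / ((x - Re w)\<^sup>2 + (Im w - s)\<^sup>2))" for x
    proof -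
      have "(Complex x s - p) * (Complex x s - w) = of_real ((x - Re w)\<^sup>2 + (Im w - s)\<^sup>2)"
        by (simp add: complex_eq_iff Imp Rep power2_eq_square algebra_simps)
      then show ?thesis by simp
    qed
    moreover have "(\<integral>x. 1 / ((x - Re w)\<^sup>2 + (Im w - s)\<^sup>2) \<partial>lborel) = pi / (Im w - s)"
      using s by (intro has_bochner_integral_integral_eq has_bochner_integral_poisson_kernel) simp
    ultimately show ?thesis by (simp only: integral_complex_of_real)
  qed
  moreover have "C0 * of_real (pi / (Im w - s)) = 2 * pi * \<i> * f w"
  proof -
    have "w - p = 2 * \<i> * of_real (Im w - s)" by (simp add: complex_eq_iff Imp Rep)
    moreover have "f w * (2 * \<i> * of_real r) * of_real (pi / r) = 2 * pi * \<i> * f w" if "r \<noteq> 0" for r :: real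
      using that by simp
    ultimately show ?thesis using s by (simp only: C0_def)
  qed
  ultimately show ?thesis using s Imp by simp
qed

text \<open>
  The product of two Hardy functions is integrable and holomorphic, so its line integral is the same at
  every height, and it tends to 0 as the height grows, by dominated convergence for \<open>g\<close>. This is the orthogonality of \<open>f\<close> to the
  conjugate of \<open>g\<close>.
\<close>

lemma hardy2_product_integral_zero:
  assumes f: "f \<in> hardy2" and g: "g \<in> Hol"
    and K: "\<And>z. z \<in> upper_half_plane \<Longrightarrow> cmod (g z) \<le> K / (1 + \<bar>Re z\<bar>)"
    and lim: "\<And>x. ((\<lambda>t. g (Complex x t)) \<longlongrightarrow> 0) at_top" and y: "y > 0"
  shows "(\<integral>x. f (Complex x y) * g (Complex x y) \<partial>lborel) = 0"
proof -
  have gh: "g \<in> hardy2" using hardy2I_decay[OF g K] .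
  let ?H = "\<lambda>z. f z * g z"
  obtain N1 where N1: "N1 \<ge> 0" "\<And>y. y > 0 \<Longrightarrow> (\<integral>x. (cmod (f (Complex x y)))\<^sup>2 \<partial>lborel) \<le> N1"
    using f hardy2E by metis
  obtain N2 where N2: "N2 \<ge> 0" "\<And>y. y > 0 \<Longrightarrow> (\<integral>x. (cmod (g (Complex x y)))\<^sup>2 \<partial>lborel) \<le> N2"
    using gh hardy2E by metis
  have norm_H: "(\<integral>x. cmod (?H (Complex x t)) \<partial>lborel)
      \<le> sqrt N1 * sqrt (\<integral>x. (cmod (g (Complex x t)))\<^sup>2 \<partial>lborel)" if "t > 0" for t
  proof -
    have "(\<integral>x. cmod (?H (Complex x t)) \<partial>lborel)
        \<le> sqrt (\<integral>x. (cmod (f (Complex x t)))\<^sup>2 \<partial>lborel) * sqrt (\<integral>x. (cmod (g (Complex x t)))\<^sup>2 \<partial>lborel)"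
      using hardy2_pairing(3)[OF f gh that that] by (simp add: norm_mult)
    also have "\<dots> \<le> sqrt N1 * sqrt (\<integral>x. (cmod (g (Complex x t)))\<^sup>2 \<partial>lborel)"
      using N1(2)[OF that] by (intro mult_right_mono) auto
    finally show ?thesis .
  qed
  have shift: "(\<integral>x. ?H (Complex x y) \<partial>lborel) = (\<integral>x. ?H (Complex x t) \<partial>lborel)" if t: "t \<ge> y" for t
  proof (rule line_integral_shift[where a = 0 and b = "t + 1" and r = 0 and C = "sqrt N1 * sqrt N2"])
    have "f holomorphic_on upper_half_plane" "g holomorphic_on upper_half_plane"
      using f g hardy2_Hol by (auto simp: Hol_def)
    then have "?H holomorphic_on upper_half_plane" by (intro holomorphic_intros)
    then show "?H holomorphic_on {z. 0 < Im z \<and> Im z < t + 1}"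
      by (rule holomorphic_on_subset) (auto simp: upper_half_plane_def)
    show "integrable lborel (\<lambda>x. ?H (Complex x y))" "integrable lborel (\<lambda>x. ?H (Complex x t))"
      using y t by (intro hardy2_pairing(2) f gh; simp)+
    show "(\<integral>\<^sup>+x. ennreal (cmod (?H (Complex x u))) * indicator {x. 0 \<le> \<bar>x\<bar>} x \<partial>lborel) \<le> ennreal (sqrt N1 * sqrt N2)"
      if "y \<le> u" "u \<le> t" for u
    proof -
      have u: "u > 0" using that y by simp
      have "(\<integral>\<^sup>+x. ennreal (cmod (?H (Complex x u))) * indicator {x. 0 \<le> \<bar>x\<bar>} x \<partial>lborel)
        = ennreal (\<integral>x. cmod (?H (Complex x u)) \<partial>lborel)"
        using nn_integral_eq_integral[OF integrable_norm[OF hardy2_pairing(2)[OF f gh u u]]] by simp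
      also have "\<dots> \<le> ennreal (sqrt N1 * sqrt N2)"
        using N1(1) N2(2)[OF u] by (intro ennreal_leI order_trans[OF norm_H[OF u]] mult_left_mono) auto
      finally show ?thesis .
    qed
  qed (use y t in auto)
  have "(\<lambda>n. cmod (\<integral>x. ?H (Complex x y) \<partial>lborel)) \<longlonglongrightarrow> 0"
  proof (rule Lim_null_comparison)
    show "\<forall>\<^sub>F n in sequentially. norm (cmod (\<integral>x. ?H (Complex x y) \<partial>lborel))
       \<le> sqrt N1 * sqrt (\<integral>x. (cmod (g (Complex x (y + real n))))\<^sup>2 \<partial>lborel)"
    proof (intro always_eventually allI)
      fix n
      have "cmod (\<integral>x. ?H (Complex x y) \<partial>lborel) \<le> (\<integral>x. cmod (?H (Complex x (y + real n))) \<partial>lborel)"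
        by (subst shift[of "y + real n"]) (auto intro: integral_norm_bound)
      also note norm_H
      finally show "norm (cmod (\<integral>x. ?H (Complex x y) \<partial>lborel))
       \<le> sqrt N1 * sqrt (\<integral>x. (cmod (g (Complex x (y + real n))))\<^sup>2 \<partial>lborel)"
        using y by simp
    qed
    have "(\<lambda>n. \<integral>x. (cmod (g (Complex x (y + real n))))\<^sup>2 \<partial>lborel) \<longlonglongrightarrow> 0"
    proof (rule dominated_L2_null[where K = K])
      show "(\<lambda>x. g (Complex x (y + real n))) \<in> borel_measurable borel" for n
        using g y by (auto intro!: Hol_measurable_line)
      show "cmod (g (Complex x (y + real n))) \<le> K / (1 + \<bar>x\<bar>)" for n x
        using K[of "Complex x (y + real n)"] y by simp
      have "filterlim (\<lambda>n. y + real n) at_top sequentially"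
        by (intro filterlim_tendsto_add_at_top[OF tendsto_const] filterlim_real_sequentially)
      then show "AE x in lborel. (\<lambda>n. g (Complex x (y + real n))) \<longlonglongrightarrow> 0"
        using filterlim_compose[OF lim] by auto
    qed
    then show "(\<lambda>n. sqrt N1 * sqrt (\<integral>x. (cmod (g (Complex x (y + real n))))\<^sup>2 \<partial>lborel)) \<longlonglongrightarrow> 0"
      using tendsto_real_sqrt[of _ 0 sequentially] by (intro tendsto_mult_right_zero) simp
  qed
  then show ?thesis
    by (simp add: LIMSEQ_const_iff)
qed

section \<open>Cauchy transforms of discrete measures on the naturals\<close>

definition cauchy_sum :: "(nat \<Rightarrow> complex) \<Rightarrow> complex \<Rightarrow> complex" where
  "cauchy_sum c z = (\<Sum>k. c k / (z - of_nat k))"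

lemma cauchy_sum_bound:
  assumes c: "summable (\<lambda>k. cmod (c k))" and d: "d > 0" "\<And>k. d \<le> cmod (z - of_nat k)"
  shows "summable (\<lambda>k. cmod (c k / (z - of_nat k)))"
    and "cmod (cauchy_sum c z) \<le> (\<Sum>k. cmod (c k)) / d"
proof -
  have le: "cmod (c k / (z - of_nat k)) \<le> cmod (c k) / d" for k
    using d(2)[of k] d(1) by (auto simp: norm_divide intro!: divide_left_mono mult_pos_pos)
  have sd: "summable (\<lambda>k. cmod (c k) / d)"
    using c by (rule summable_divide)
  show s: "summable (\<lambda>k. cmod (c k / (z - of_nat k)))"
    by (rule summable_comparison_test'[OF sd]) (use le in auto)
  have "cmod (cauchy_sum c z) \<le> (\<Sum>k. cmod (c k / (z - of_nat k)))"
    unfolding cauchy_sum_def using s by (rule summable_norm)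
  also have "\<dots> \<le> (\<Sum>k. cmod (c k) / d)"
    by (intro suminf_le le s sd)
  also have "\<dots> = (\<Sum>k. cmod (c k)) / d"
    using c by (rule suminf_divide)
  finally show "cmod (cauchy_sum c z) \<le> (\<Sum>k. cmod (c k)) / d" .
qed

lemma Im_le_dist_of_nat: "\<bar>Im z\<bar> \<le> cmod (z - of_nat k)"
  using abs_Im_le_cmod[of "z - of_nat k"] by simp

lemma dist_of_nat_bounded_below:
  fixes z :: complex
  assumes "z \<notin> \<nat>"
  obtains e where "e > 0" "\<And>k. e \<le> cmod (z - of_nat k)"
proof -
  have "open (-\<nat> :: complex set)" by (simp add: open_Compl)
  then obtain e where e: "e > 0" "ball z e \<subseteq> -\<nat>"
    by (rule openE) (use assms in auto)
  have "e \<le> cmod (z - of_nat k)" for k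
  proof (rule ccontr)
    assume "\<not> e \<le> cmod (z - of_nat k)"
    then have "of_nat k \<in> ball z e" by (simp add: dist_norm)
    with e(2) show False by auto
  qed
  with e(1) that show thesis by blast
qed

lemma cauchy_sum_holomorphic:
  assumes c: "summable (\<lambda>k. cmod (c k))"
  shows "cauchy_sum c holomorphic_on (-\<nat>)"
proof (rule holomorphic_uniform_sequence)
  show op: "open (- \<nat> :: complex set)" by (simp add: open_Compl)
  show "(\<lambda>z. \<Sum>k<n. c k / (z - of_nat k)) holomorphic_on -\<nat>" for n
    by (intro holomorphic_intros) auto
  fix x :: complex assume "x \<in> -\<nat>"
  then obtain e where e: "e > 0" "\<And>k. e \<le> cmod (x - of_nat k)"
    using dist_of_nat_bounded_below by (metis ComplD)
  have "uniform_limit (cball x (e/2)) (\<lambda>n z. \<Sum>k<n. c k / (z - of_nat k)) (\<lambda>z. \<Sum>k. c k / (z - of_nat k)) sequentially"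
  proof (rule Weierstrass_m_test)
    show "summable (\<lambda>k. cmod (c k) / (e/2))"
      using c by (rule summable_divide)
    show "norm (c k / (z - of_nat k)) \<le> cmod (c k) / (e/2)" if "z \<in> cball x (e/2)" for k z
    proof -
      have "e \<le> dist x (of_nat k)" using e(2) by (simp add: dist_norm)
      moreover have "dist x z \<le> e/2" using that by simp
      ultimately have "e/2 \<le> dist z (of_nat k)"
        using dist_triangle[of x "of_nat k" z] by linarith
      then show ?thesis
        unfolding norm_divide dist_norm using e by (intro divide_left_mono) (auto intro!: mult_pos_pos)
    qed
  qed
  moreover have "cball x (e/2) \<subseteq> -\<nat>"
  proof (rule ccontr)
    assume "\<not> cball x (e/2) \<subseteq> -\<nat>"
    then obtain k :: nat where "of_nat k \<in> cball x (e/2)" by (auto simp: Nats_def)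
    then show False using e(1) e(2)[of k] by (simp add: dist_norm)
  qed
  ultimately show "\<exists>d>0. cball x d \<subseteq> -\<nat> \<and>
      uniform_limit (cball x d) (\<lambda>n z. \<Sum>k<n. c k / (z - of_nat k)) (cauchy_sum c) sequentially"
    using e by (intro exI[of _ "e/2"]) (simp add: cauchy_sum_def[abs_def])
qed

lemma upper_half_plane_not_Nats: "z \<in> upper_half_plane \<Longrightarrow> z \<in> -\<nat>"
  by (auto simp: upper_half_plane_def Nats_def)

text \<open>
  The weights are recovered from the Cauchy transform: only the term with pole at \<open>n\<close> survives
  multiplication by the vanishing factor \<open>\<i> * y\<close>.
\<close>

lemma cauchy_sum_residue:
  assumes c: "summable (\<lambda>k. cmod (c k))"
  shows "((\<lambda>y. \<i> * of_real y * cauchy_sum c (of_nat n + \<i> * of_real y)) \<longlongrightarrow> c n) (at_right 0)"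
proof -
  define a where "a k y = \<i> * of_real y * (c k / (of_nat n + \<i> * of_real y - of_nat k))" for k and y :: real
  have bound: "cmod (a k y) \<le> cmod (c k)" for k y
  proof -
    have le: "\<bar>y\<bar> \<le> cmod (of_nat n + \<i> * of_real y - of_nat k)"
      using Im_le_dist_of_nat[of "of_nat n + \<i> * of_real y" k] by simp
    show ?thesis
    proof (cases "y = 0")
      case False
      have "cmod (a k y) = \<bar>y\<bar> * cmod (c k) / cmod (of_nat n + \<i> * of_real y - of_nat k)"
        by (simp add: a_def norm_mult norm_divide)
      also have "\<dots> \<le> \<bar>y\<bar> * cmod (c k) / \<bar>y\<bar>"
        using le False by (intro divide_left_mono) (auto intro!: mult_pos_pos)
      finally show ?thesis using False by simp
    qed (simp add: a_def)
  qed
  have lim: "((\<lambda>y. a k y) \<longlongrightarrow> (if k = n then c n else 0)) (at_right 0)" for k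
  proof (cases "k = n")
    case True
    have "\<forall>\<^sub>F y in at_right 0. a k y = c n"
      using eventually_at_right_less[of 0]
      by eventually_elim (simp add: a_def True)
    then show ?thesis using True by (simp add: tendsto_eventually)
  next
    case False
    then have "((\<lambda>y. a k y) \<longlongrightarrow> \<i> * of_real 0 * (c k / (of_nat n + \<i> * of_real 0 - of_nat k))) (at_right 0)"
      unfolding a_def by (intro tendsto_intros) simp
    then show ?thesis using False by simp
  qed
  have "((\<lambda>y. \<Sum>k. a k y) \<longlongrightarrow> (\<Sum>k. if k = n then c n else 0)) (at_right 0)"
    using tannerys_theorem[of a "\<lambda>k. if k = n then c n else 0" "at_right 0" "\<lambda>k. cmod (c k)", OF lim _ c] bound
    by (simp add: always_eventually)
  moreover have "(\<Sum>k. if k = n then c n else 0) = c n"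
    using sums_single[of n "\<lambda>_. c n"] by (simp add: sums_iff)
  moreover have "\<forall>\<^sub>F y in at_right 0. (\<Sum>k. a k y) = \<i> * of_real y * cauchy_sum c (of_nat n + \<i> * of_real y)"
    using eventually_at_right_less[of 0]
  proof eventually_elim
    case (elim y)
    have "summable (\<lambda>k. c k / (of_nat n + \<i> * of_real y - of_nat k))"
      using elim Im_le_dist_of_nat[of "of_nat n + \<i> * of_real y"]
      by (intro summable_norm_cancel[OF cauchy_sum_bound(1)[OF c, of y]]) auto
    then show ?case
      unfolding a_def cauchy_sum_def by (rule suminf_mult)
  qed
  ultimately show ?thesis
    by (auto intro: Lim_transform_eventually)
qed

lemma cauchy_sum_unique:
  assumes "summable (\<lambda>k. cmod (c k))" "summable (\<lambda>k. cmod (d k))"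
    and eq: "\<And>z. z \<in> upper_half_plane \<Longrightarrow> cauchy_sum c z = cauchy_sum d z"
  shows "c = d"
proof
  fix n
  have "\<forall>\<^sub>F y in at_right 0. \<i> * of_real y * cauchy_sum d (of_nat n + \<i> * of_real y)
      = \<i> * of_real y * cauchy_sum c (of_nat n + \<i> * of_real y)"
    using eventually_at_right_less[of 0]
    by eventually_elim (simp add: eq upper_half_plane_def)
  from Lim_transform_eventually[OF cauchy_sum_residue[OF assms(2), of n] this]
  show "c n = d n"
    using cauchy_sum_residue[OF assms(1), of n] by (intro tendsto_unique[of "at_right 0"]) auto
qed

lemma cauchy_sum_cnj:
  assumes c: "summable (\<lambda>k. cmod (c k))" and z: "z \<notin> \<nat>" "Im z = 0"
  shows "cnj (cauchy_sum c z) = cauchy_sum (\<lambda>k. cnj (c k)) z"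
proof -
  obtain e where e: "e > 0" "\<And>k. e \<le> cmod (z - of_nat k)"
    using dist_of_nat_bounded_below[OF z(1)] by blast
  have "summable (\<lambda>k. c k / (z - of_nat k))"
    by (intro summable_norm_cancel[OF cauchy_sum_bound(1)[OF c e]])
  then have "(\<lambda>k. cnj (c k / (z - of_nat k))) sums cnj (cauchy_sum c z)"
    unfolding cauchy_sum_def sums_cnj by (rule summable_sums)
  moreover have "cnj z = z" using z(2) by (simp add: complex_eq_iff)
  ultimately show ?thesis
    by (simp add: cauchy_sum_def sums_iff)
qed

lemma cauchy_sum_single: "cauchy_sum (\<lambda>j. if j = k then a else 0) z = a / (z - of_nat k)"
proof -
  have "(\<lambda>j. if j = k then a / (z - of_nat j) else 0) sums (a / (z - of_nat k))"
    by (rule sums_single)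
  moreover have "(if j = k then a else 0) / (z - of_nat j) = (if j = k then a / (z - of_nat j) else 0)" for j
    by simp
  ultimately show ?thesis
    unfolding cauchy_sum_def by (simp add: sums_iff)
qed

lemma upper_half_planeD: "z \<in> upper_half_plane \<Longrightarrow> 0 \<le> Im z \<and> z \<notin> \<nat>"
  using upper_half_plane_not_Nats[of z] by (auto simp: upper_half_plane_def)

lemma vertical_tendsto:
  assumes "(f \<longlongrightarrow> l) (at (of_real x) within upper_half_plane)"
  shows "((\<lambda>y. f (Complex x y)) \<longlongrightarrow> l) (at_right 0)"
proof (rule filterlim_compose[OF assms])
  show "filterlim (Complex x) (at (complex_of_real x) within upper_half_plane) (at_right 0)"
    unfolding filterlim_at
  proof
    show "\<forall>\<^sub>F y in at_right 0. Complex x y \<in> upper_half_plane \<and> Complex x y \<noteq> complex_of_real x"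
      using eventually_at_right_less[of 0] by eventually_elim (auto simp: complex_eq_iff)
    show "(Complex x \<longlongrightarrow> complex_of_real x) (at_right 0)"
      unfolding Complex_eq_add[abs_def] by (auto intro!: tendsto_eq_intros)
  qed
qed

lemma isCont_cauchy_sum:
  assumes "summable (\<lambda>k. cmod (c k))" "complex_of_real x \<notin> \<nat>"
  shows "isCont (cauchy_sum c) (of_real x)"
  using holomorphic_on_imp_continuous_on[OF cauchy_sum_holomorphic[OF assms(1)]] assms(2)
  by (simp add: continuous_on_eq_continuous_at open_Compl)

lemma cauchy_sum_upper_half_plane:
  assumes "summable (\<lambda>k. cmod (c k))" "z \<in> upper_half_plane"
  shows "summable (\<lambda>k. cmod (c k / (z - of_nat k)))"
    and "cmod (cauchy_sum c z) \<le> (\<Sum>k. cmod (c k)) / Im z"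
  using cauchy_sum_bound[OF assms(1), of "Im z" z] assms(2) Im_le_dist_of_nat[of z]
  by (auto simp: upper_half_plane_def)

lemma AE_not_Nats: "AE x in lborel. complex_of_real x \<notin> \<nat>"
proof -
  have "countable (\<nat> :: real set)" by (simp add: Nats_def)
  then have "AE x in lborel. x \<notin> (\<nat> :: real set)"
    by (rule countable_imp_null_set_lborel[THEN AE_not_in])
  then show ?thesis
    by eventually_elim (metis Nats_cases of_nat_in_Nats of_real_eq_iff of_real_of_nat_eq)
qed

lemma cauchy_sum_cmult:
  assumes "summable (\<lambda>k. cmod (c k))" "z \<in> upper_half_plane"
  shows "cauchy_sum (\<lambda>k. a * c k) z = a * cauchy_sum c z"
  using suminf_mult[OF summable_norm_cancel[OF cauchy_sum_upper_half_plane(1)[OF assms]], of a]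
  by (simp add: cauchy_sum_def)


section \<open>Inner functions with a discrete Clark measure\<close>

text \<open>
  The measure with mass \<open>m k\<close> at the natural number \<open>k\<close> is, up to normalisation, the Clark measure of
  \<open>clark_inner\<close> at the point 1. Summability of the square roots gives absolutely convergent expansions with coefficients
  of size \<open>sqrt (m k)\<close>, which is the size that membership in the model space provides.
\<close>

locale clark_weights =
  fixes m :: "nat \<Rightarrow> real"
  assumes m_pos: "0 < m k" and m_le_1: "m k \<le> 1" and summable_sqrt_m: "summable (\<lambda>k. sqrt (m k))"
begin

definition mass :: real where "mass = (\<Sum>k. m k)"

text \<open>
  The Herglotz function of the measure: the sum of \<open>m k / (k - z)\<close>. It has nonnegative imaginary part in
  the upper half-plane and is real on the real axis, so that its Cayley transform is inner.
\<close>

definition herglotz :: "complex \<Rightarrow> complex" where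
  "herglotz z = - cauchy_sum (\<lambda>k. of_real (m k)) z"

definition clark_inner :: "complex \<Rightarrow> complex" where
  "clark_inner z = (if z \<in> upper_half_plane then (herglotz z - \<i>) / (herglotz z + \<i>) else 0)"

text \<open>
  The synthesis map from coefficients to model space elements. Up to the weights it inverts restriction to
  the support of the Clark measure; note that \<open>1 / (herglotz z + \<i>)\<close> is \<open>(1 - clark_inner z) / (2 * \<i>)\<close>.
\<close>

definition synth :: "(nat \<Rightarrow> complex) \<Rightarrow> complex \<Rightarrow> complex" where
  "synth c z = (if z \<in> upper_half_plane then cauchy_sum c z / (herglotz z + \<i>) else 0)"

definition atom :: "nat \<Rightarrow> complex \<Rightarrow> complex" where
  "atom k = synth (\<lambda>j. if j = k then 1 else 0)"

lemma m_le_sqrt: "m k \<le> sqrt (m k)"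
  using m_pos[of k] m_le_1[of k] by (intro real_le_rsqrt) (simp add: power2_eq_square mult_left_le)

lemma summable_m: "summable m"
  by (rule summable_comparison_test'[OF summable_sqrt_m]) (use m_le_sqrt m_pos in \<open>auto simp: less_imp_le\<close>)

lemma summable_norm_m: "summable (\<lambda>k. cmod (of_real (m k)))"
  using summable_m m_pos by (simp add: abs_of_pos)

lemma mass_nonneg: "mass \<ge> 0"
  unfolding mass_def by (intro suminf_nonneg summable_m less_imp_le m_pos)

lemma herglotz_holomorphic: "herglotz holomorphic_on (-\<nat>)"
  unfolding herglotz_def[abs_def] by (intro holomorphic_intros cauchy_sum_holomorphic summable_norm_m)

lemma herglotz_sums:
  assumes "z \<notin> \<nat>"
  shows "(\<lambda>k. of_real (m k) / (of_nat k - z)) sums herglotz z"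
proof -
  obtain e where e: "e > 0" "\<And>k. e \<le> cmod (z - of_nat k)"
    using dist_of_nat_bounded_below[OF assms] by blast
  have "summable (\<lambda>k. of_real (m k) / (z - of_nat k))"
    by (intro summable_norm_cancel[OF cauchy_sum_bound(1)[OF summable_norm_m e]])
  then have "(\<lambda>k. - (of_real (m k) / (z - of_nat k))) sums herglotz z"
    unfolding herglotz_def cauchy_sum_def by (intro sums_minus summable_sums)
  moreover have "- (of_real (m k) / (z - of_nat k)) = of_real (m k) / (of_nat k - z)" for k
  proof -
    have "of_nat k - z = - (z - of_nat k)" by simp
    then show ?thesis by (simp only: divide_minus_right minus_minus)
  qed
  ultimately show ?thesis by simp
qed

lemma Im_herglotz_nonneg:
  assumes "Im z \<ge> 0" "z \<notin> \<nat>"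
  shows "Im (herglotz z) \<ge> 0"
proof -
  have sums: "(\<lambda>k. Im (of_real (m k) / (of_nat k - z))) sums Im (herglotz z)"
    by (intro sums_Im herglotz_sums assms)
  have nonneg: "0 \<le> Im (of_real (m k) / (of_nat k - z))" for k
    using assms m_pos[of k] by (simp add: Im_divide)
  show ?thesis
    by (rule sums_le[OF nonneg sums_zero sums])
qed

lemma Im_herglotz_real:
  assumes "Im z = 0" "z \<notin> \<nat>"
  shows "Im (herglotz z) = 0"
proof -
  have "(\<lambda>k. Im (of_real (m k) / (of_nat k - z))) sums Im (herglotz z)"
    by (intro sums_Im herglotz_sums assms)
  moreover have "Im (of_real (m k) / (of_nat k - z)) = 0" for k
    using assms by (simp add: Im_divide)
  ultimately show ?thesis by (simp add: sums_iff)
qed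

lemma norm_herglotz_plus_i:
  assumes "Im z \<ge> 0" "z \<notin> \<nat>"
  shows "1 \<le> cmod (herglotz z + \<i>)"
  using abs_Im_le_cmod[of "herglotz z + \<i>"] Im_herglotz_nonneg[OF assms] by simp

lemma herglotz_plus_i_nonzero:
  assumes "Im z \<ge> 0" "z \<notin> \<nat>"
  shows "herglotz z + \<i> \<noteq> 0"
  using norm_herglotz_plus_i[OF assms] by auto

lemma Hol_quotient:
  assumes "F holomorphic_on upper_half_plane"
  shows "(\<lambda>z. if z \<in> upper_half_plane then F z / (herglotz z + \<i>) else 0) \<in> Hol"
proof -
  have "herglotz holomorphic_on upper_half_plane"
    using upper_half_plane_not_Nats by (intro holomorphic_on_subset[OF herglotz_holomorphic]) auto
  then have "(\<lambda>z. F z / (herglotz z + \<i>)) holomorphic_on upper_half_plane"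
    using herglotz_plus_i_nonzero upper_half_planeD by (intro holomorphic_intros assms) auto
  then have "(\<lambda>z. if z \<in> upper_half_plane then F z / (herglotz z + \<i>) else 0) holomorphic_on upper_half_plane"
    by (rule holomorphic_transform) simp
  then show ?thesis by (simp add: Hol_def)
qed

lemma clark_inner_Hol: "clark_inner \<in> Hol"
  unfolding clark_inner_def[abs_def]
  using upper_half_plane_not_Nats
  by (intro Hol_quotient holomorphic_intros holomorphic_on_subset[OF herglotz_holomorphic]) auto

lemma norm_clark_inner_le_1: "cmod (clark_inner z) \<le> 1"
proof (cases "z \<in> upper_half_plane")
  case True
  note z = upper_half_planeD[OF True]
  have "(cmod (herglotz z - \<i>))\<^sup>2 \<le> (cmod (herglotz z + \<i>))\<^sup>2"
    using Im_herglotz_nonneg[of z] z unfolding cmod_power2 by (simp add: power2_eq_square algebra_simps)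
  then have "cmod (herglotz z - \<i>) \<le> cmod (herglotz z + \<i>)"
    by (rule power2_le_imp_le) simp
  then show ?thesis
    using True norm_herglotz_plus_i[of z] z by (simp add: clark_inner_def norm_divide divide_le_eq)
qed (simp add: clark_inner_def)

lemma isCont_herglotz: "complex_of_real x \<notin> \<nat> \<Longrightarrow> isCont herglotz (of_real x)"
  using holomorphic_on_imp_continuous_on[OF herglotz_holomorphic]
  by (simp add: continuous_on_eq_continuous_at open_Compl)

text \<open>
  Away from the naturals everything extends continuously to the real line, where \<open>herglotz\<close> is real.
\<close>

lemma boundary_quotient_tendsto:
  assumes F: "isCont F (of_real x)" and x: "complex_of_real x \<notin> \<nat>"
  shows "((\<lambda>z. if z \<in> upper_half_plane then F z / (herglotz z + \<i>) else 0) \<longlongrightarrow>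
      F (of_real x) / (herglotz (of_real x) + \<i>)) (at (of_real x) within upper_half_plane)"
proof -
  have "isCont (\<lambda>z. F z / (herglotz z + \<i>)) (of_real x)"
    using herglotz_plus_i_nonzero[of "of_real x"] x by (intro continuous_intros F isCont_herglotz) auto
  then have "((\<lambda>z. F z / (herglotz z + \<i>)) \<longlongrightarrow> F (of_real x) / (herglotz (of_real x) + \<i>))
      (at (of_real x) within upper_half_plane)"
    unfolding isCont_def by (rule tendsto_within_subset) simp
  then show ?thesis
    by (rule Lim_transform_eventually) (simp add: eventually_at_filter)
qed

lemma clark_inner_tendsto:
  assumes "complex_of_real x \<notin> \<nat>"
  shows "(clark_inner \<longlongrightarrow> (herglotz (of_real x) - \<i>) / (herglotz (of_real x) + \<i>))
      (at (of_real x) within upper_half_plane)"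
  unfolding clark_inner_def[abs_def]
  by (rule boundary_quotient_tendsto[OF _ assms]) (intro continuous_intros isCont_herglotz assms)

lemma synth_tendsto:
  assumes "summable (\<lambda>k. cmod (c k))" "complex_of_real x \<notin> \<nat>"
  shows "(synth c \<longlongrightarrow> cauchy_sum c (of_real x) / (herglotz (of_real x) + \<i>))
      (at (of_real x) within upper_half_plane)"
  unfolding synth_def[abs_def]
  by (rule boundary_quotient_tendsto[OF isCont_cauchy_sum[OF assms] assms(2)])

lemma inner_function_clark_inner: "inner_function clark_inner"
  unfolding inner_function_def
proof (intro conjI clark_inner_Hol)
  show "bounded (clark_inner ` upper_half_plane)"
    using norm_clark_inner_le_1 by (intro boundedI) auto
  show "AE x in lborel. \<exists>l. cmod l = 1 \<and> has_nontangential_limit clark_inner l x"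
    using AE_not_Nats
  proof eventually_elim
    case (elim x)
    define l where "l = (herglotz (of_real x) - \<i>) / (herglotz (of_real x) + \<i>)"
    have "Im (herglotz (of_real x)) = 0" using Im_herglotz_real elim by simp
    then have "cmod (herglotz (of_real x) - \<i>) = cmod (herglotz (of_real x) + \<i>)"
      by (simp add: cmod_def)
    moreover have "herglotz (of_real x) + \<i> \<noteq> 0" using herglotz_plus_i_nonzero elim by simp
    ultimately have "cmod l = 1" by (simp add: l_def norm_divide)
    moreover have "has_nontangential_limit clark_inner l x"
      unfolding has_nontangential_limit_def l_def
      using clark_inner_tendsto[OF elim]
      by (auto intro: tendsto_within_subset simp: stolz_angle_def upper_half_plane_def)
    ultimately show ?case by blast
  qed
qed

lemma atom_eq: "atom k z = (if z \<in> upper_half_plane then 1 / ((z - of_nat k) * (herglotz z + \<i>)) else 0)"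
  by (simp add: atom_def synth_def cauchy_sum_single)

text \<open>
  Near its own pole the factor \<open>z - k\<close> is compensated by the pole of \<open>herglotz\<close>, whose residue has
  size \<open>m k\<close>; the other poles are at distance at least 1/2 there. Further away \<open>\<bar>herglotz z + \<i>\<bar> \<ge> 1\<close>
  suffices, and the two regimes meet at distance comparable to \<open>m k\<close>.
\<close>

lemma norm_atom_square_le:
  assumes z: "z \<in> upper_half_plane"
  shows "(cmod (atom k z))\<^sup>2 \<le> 8 * (1 + 2 * mass)\<^sup>2 / ((Re z - of_nat k)\<^sup>2 + (m k)\<^sup>2)"
proof -
  define d where "d = cmod (z - of_nat k)"
  define Q where "Q = cmod ((z - of_nat k) * (herglotz z + \<i>))"
  define A where "A = 1 + 2 * mass"
  have A: "A \<ge> 1" using mass_nonneg by (simp add: A_def)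
  have zN: "z \<notin> \<nat>" "Im z \<ge> 0" using upper_half_planeD[OF z] by auto
  have dpos: "d > 0" using zN by (auto simp: d_def)
  have Qd: "Q \<ge> d"
    using norm_herglotz_plus_i[OF zN(2,1)] dpos by (simp add: Q_def d_def norm_mult)
  have main: "d\<^sup>2 + (m k)\<^sup>2 \<le> 8 * A\<^sup>2 * Q\<^sup>2"
  proof (cases "m k \<le> 2 * A * d")
    case True
    have "(m k)\<^sup>2 \<le> (2 * A * d)\<^sup>2" using True m_pos[of k] by (intro power_mono) auto
    then have "(m k)\<^sup>2 \<le> 4 * (A\<^sup>2 * d\<^sup>2)" by (simp add: power_mult_distrib)
    moreover have "d\<^sup>2 \<le> A\<^sup>2 * d\<^sup>2" using A by (simp add: mult_le_cancel_right1)
    ultimately have "d\<^sup>2 + (m k)\<^sup>2 \<le> 8 * A\<^sup>2 * d\<^sup>2"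
      using zero_le_power2[of d] unfolding mult.assoc by linarith
    also have "\<dots> \<le> 8 * A\<^sup>2 * Q\<^sup>2" using Qd dpos by (intro mult_left_mono power_mono) auto
    finally show ?thesis .
  next
    case False
    then have dm: "2 * A * d < m k" by simp
    have "d \<le> A * d" using A dpos by simp
    then have dh: "d \<le> 1 / 2" using dm m_le_1[of k] by linarith
    \<comment> \<open>\<open>R\<close> collects the poles other than \<open>k\<close>.\<close>
    define R where "R = (\<lambda>j. if j = k then 0 else of_real (m j) / (of_nat j - z) :: complex)"
    have Rle: "cmod (R j) \<le> 2 * m j" for j
    proof (cases "j = k")
      case False
      have "1 \<le> \<bar>of_nat j - of_nat k :: real\<bar>" using False by linarith
      also have "\<dots> = cmod (of_nat j - of_nat k)"
        by (metis norm_of_real of_real_diff of_real_of_nat_eq)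
      also have "\<dots> \<le> cmod (of_nat j - z) + d"
        unfolding d_def using norm_triangle_ineq[of "of_nat j - z" "z - of_nat k"] by simp
      finally have "1 / 2 \<le> cmod (of_nat j - z)" using dh by simp
      then have "m j / cmod (of_nat j - z) \<le> m j / (1/2)"
        using m_pos[of j] by (intro divide_left_mono) (auto intro!: mult_pos_pos)
      then show ?thesis using False m_pos[of j] by (simp add: R_def norm_divide)
    qed (use m_pos[of k] in \<open>simp add: R_def\<close>)
    have sR: "summable (\<lambda>j. cmod (R j))"
      by (rule summable_comparison_test'[OF summable_mult[OF summable_m, of 2]]) (use Rle in auto)
    have "cmod (\<Sum>j. R j) \<le> (\<Sum>j. cmod (R j))" using sR by (rule summable_norm)
    also have "\<dots> \<le> (\<Sum>j. 2 * m j)" by (intro suminf_le Rle sR summable_mult summable_m)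
    also have "\<dots> = 2 * mass" unfolding mass_def by (rule suminf_mult[OF summable_m])
    finally have Rs: "cmod (\<Sum>j. R j) \<le> 2 * mass" .
    have "(\<lambda>j. (if j = k then of_real (m k) / (of_nat k - z) else 0) + R j) sums (of_real (m k) / (of_nat k - z) + (\<Sum>j. R j))"
      by (intro sums_add sums_single[of k "\<lambda>_. of_real (m k) / (of_nat k - z)"] summable_sums summable_norm_cancel[OF sR])
    moreover have "(\<lambda>j. (if j = k then of_real (m k) / (of_nat k - z) else 0) + R j) = (\<lambda>j. of_real (m j) / (of_nat j - z))"
      by (auto simp: R_def)
    ultimately have G: "herglotz z = of_real (m k) / (of_nat k - z) + (\<Sum>j. R j)"
      using sums_unique2[OF herglotz_sums[OF zN(1)]] by simp
    have zk: "z - of_nat k \<noteq> 0" "of_nat k - z \<noteq> 0" using dpos by (auto simp: d_def)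
    have "(z - of_nat k) * (herglotz z + \<i>) = (z - of_nat k) * ((\<Sum>j. R j) + \<i>) - of_real (m k)"
      unfolding G using zk by (simp add: field_simps)
    then have "Q \<ge> m k - cmod ((z - of_nat k) * ((\<Sum>j. R j) + \<i>))"
      unfolding Q_def using norm_triangle_ineq2[of "of_real (m k)" "(z - of_nat k) * ((\<Sum>j. R j) + \<i>)"] m_pos[of k]
      by (simp add: norm_minus_commute)
    moreover have "cmod ((z - of_nat k) * ((\<Sum>j. R j) + \<i>)) \<le> d * A"
      unfolding norm_mult d_def[symmetric] A_def
      using norm_triangle_ineq[of "\<Sum>j. R j" \<i>] Rs dpos by (intro mult_left_mono) auto
    moreover have "2 * (d * A) < m k" using dm by (simp only: mult_ac)
    ultimately have Q: "Q \<ge> m k / 2" by linarith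
    have "d \<le> m k" using \<open>d \<le> A * d\<close> dm dpos unfolding mult.assoc by linarith
    then have "d\<^sup>2 \<le> (m k)\<^sup>2" using dpos by (intro power_mono) auto
    then have "d\<^sup>2 + (m k)\<^sup>2 \<le> 8 * (m k / 2)\<^sup>2" by (simp add: power_divide)
    also have "\<dots> \<le> 8 * Q\<^sup>2" using Q m_pos[of k] by (intro mult_left_mono power_mono) auto
    also have "\<dots> \<le> 8 * A\<^sup>2 * Q\<^sup>2" using A by (simp add: mult_le_cancel_right1)
    finally show ?thesis .
  qed
  have "(Re z - of_nat k)\<^sup>2 \<le> d\<^sup>2"
    unfolding d_def using abs_Re_le_cmod[of "z - of_nat k"] by (simp add: abs_le_square_iff[symmetric])
  then have le: "(Re z - of_nat k)\<^sup>2 + (m k)\<^sup>2 \<le> 8 * A\<^sup>2 * Q\<^sup>2" using main by linarith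
  have Qpos: "Q > 0" using Qd dpos by linarith
  have mk: "(Re z - of_nat k)\<^sup>2 + (m k)\<^sup>2 > 0" using m_pos[of k] by (intro add_nonneg_pos) auto
  have "(cmod (atom k z))\<^sup>2 = 1 / Q\<^sup>2"
    using z by (simp add: atom_eq Q_def norm_divide power_divide)
  also have "\<dots> \<le> 8 * A\<^sup>2 / ((Re z - of_nat k)\<^sup>2 + (m k)\<^sup>2)"
    using le mk Qpos by (simp add: divide_simps)
  finally show ?thesis by (simp add: A_def)
qed

end

section \<open>Synthesis of model space elements\<close>

lemma one_over_le_divide: "b \<le> B * a \<Longrightarrow> a > 0 \<Longrightarrow> b > 0 \<Longrightarrow> 1 / a \<le> B / b" for a b B :: real
  by (simp add: divide_simps mult.commute)

context clark_weights
begin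

lemma atom_Hol: "atom k \<in> Hol"
  unfolding atom_def synth_def[abs_def]
proof (rule Hol_quotient)
  have "summable (\<lambda>j. cmod (if j = k then 1 else 0))"
    by (rule summable_finite[of "{k}"]) auto
  from cauchy_sum_holomorphic[OF this]
  show "cauchy_sum (\<lambda>j. if j = k then 1 else 0) holomorphic_on upper_half_plane"
    by (rule holomorphic_on_subset) (use upper_half_plane_not_Nats in auto)
qed

text \<open>
  A bound of the form \<open>K / (1 + \<bar>Re z\<bar>)\<close> costs a factor \<open>(1 + k) / m k\<close>: the peak of the atom
  has height about \<open>1 / m k\<close> and sits at distance \<open>k\<close> from the origin.
\<close>

lemma norm_atom_le:
  assumes z: "z \<in> upper_half_plane"
  shows "cmod (atom k z) \<le> 4 * (1 + 2 * mass) * ((1 + real k) / m k) / (1 + \<bar>Re z\<bar>)"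
proof (rule power2_le_imp_le)
  define A where "A = 1 + 2 * mass"
  define x where "x = Re z"
  have A: "A \<ge> 1" using mass_nonneg by (simp add: A_def)
  have m: "0 < m k" "(m k)\<^sup>2 \<le> 1" using m_pos[of k] m_le_1[of k] by (auto simp: power_le_one)
  have "1 + \<bar>x\<bar> \<le> 1 + (real k + \<bar>x - real k\<bar>)" by simp
  also have "\<dots> \<le> (1 + real k) * (1 + \<bar>x - real k\<bar>)"
    by (simp add: algebra_simps)
  finally have "(1 + \<bar>x\<bar>)\<^sup>2 \<le> ((1 + real k) * (1 + \<bar>x - real k\<bar>))\<^sup>2"
    by (intro power_mono) auto
  also have "\<dots> = (1 + real k)\<^sup>2 * (1 + \<bar>x - real k\<bar>)\<^sup>2" by (rule power_mult_distrib)
  also have "(1 + \<bar>x - real k\<bar>)\<^sup>2 \<le> 2 * (1 + (x - real k)\<^sup>2)"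
    using sum_squares_bound[of 1 "\<bar>x - real k\<bar>"] by (simp add: power2_sum)
  finally have 1: "(1 + \<bar>x\<bar>)\<^sup>2 \<le> (1 + real k)\<^sup>2 * (2 * (1 + (x - real k)\<^sup>2))"
    by (simp add: mult_left_mono)
  have "(m k)\<^sup>2 * (1 + (x - real k)\<^sup>2) \<le> (x - real k)\<^sup>2 + (m k)\<^sup>2"
    using m by (simp add: distrib_left mult_left_le_one_le)
  then have 2: "(m k)\<^sup>2 * (1 + \<bar>x\<bar>)\<^sup>2 \<le> 2 * (1 + real k)\<^sup>2 * ((x - real k)\<^sup>2 + (m k)\<^sup>2)"
  proof -
    have "(m k)\<^sup>2 * (1 + \<bar>x\<bar>)\<^sup>2 \<le> (m k)\<^sup>2 * ((1 + real k)\<^sup>2 * (2 * (1 + (x - real k)\<^sup>2)))"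
      using 1 by (intro mult_left_mono) auto
    also have "\<dots> = 2 * (1 + real k)\<^sup>2 * ((m k)\<^sup>2 * (1 + (x - real k)\<^sup>2))" by (simp only: mult_ac)
    also have "\<dots> \<le> 2 * (1 + real k)\<^sup>2 * ((x - real k)\<^sup>2 + (m k)\<^sup>2)"
      using \<open>(m k)\<^sup>2 * (1 + (x - real k)\<^sup>2) \<le> _\<close> by (intro mult_left_mono) auto
    finally show ?thesis .
  qed
  have pos: "(x - real k)\<^sup>2 + (m k)\<^sup>2 > 0" "(m k)\<^sup>2 * (1 + \<bar>x\<bar>)\<^sup>2 > 0"
    using m by (auto intro!: add_nonneg_pos mult_pos_pos zero_less_power)
  have "(cmod (atom k z))\<^sup>2 \<le> 8 * A\<^sup>2 / ((x - real k)\<^sup>2 + (m k)\<^sup>2)"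
    unfolding A_def x_def by (rule norm_atom_square_le[OF z])
  also have "\<dots> \<le> 8 * A\<^sup>2 * (2 * (1 + real k)\<^sup>2) / ((m k)\<^sup>2 * (1 + \<bar>x\<bar>)\<^sup>2)"
  proof -
    have "1 / ((x - real k)\<^sup>2 + (m k)\<^sup>2) \<le> (2 * (1 + real k)\<^sup>2) / ((m k)\<^sup>2 * (1 + \<bar>x\<bar>)\<^sup>2)"
      by (rule one_over_le_divide[OF 2 pos])
    from mult_left_mono[OF this, of "8 * A\<^sup>2"] show ?thesis by simp
  qed
  also have "\<dots> = (4 * A * ((1 + real k) / m k) / (1 + \<bar>x\<bar>))\<^sup>2"
    by (simp add: power_divide power_mult_distrib)
  finally show "(cmod (atom k z))\<^sup>2 \<le> (4 * (1 + 2 * mass) * ((1 + real k) / m k) / (1 + \<bar>Re z\<bar>))\<^sup>2"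
    by (simp add: A_def x_def)
  show "0 \<le> 4 * (1 + 2 * mass) * ((1 + real k) / m k) / (1 + \<bar>Re z\<bar>)"
    using mass_nonneg m by simp
qed

lemma tame_atom: "tame (atom k)"
  unfolding tame_def
proof (intro conjI atom_Hol)
  show "\<exists>K. \<forall>z\<in>upper_half_plane. cmod (atom k z) \<le> K / (1 + \<bar>Re z\<bar>)"
    using norm_atom_le by blast
  have "summable (\<lambda>j. cmod (if j = k then 1 else 0))"
    by (rule summable_finite[of "{k}"]) auto
  note lim = vertical_tendsto[OF synth_tendsto[OF this]]
  show "AE x in lborel. \<exists>l. ((\<lambda>y. atom k (Complex x y)) \<longlongrightarrow> l) (at_right 0)"
    using AE_not_Nats unfolding atom_def by eventually_elim (use lim in blast)
qed

text \<open>
  Here the sharp order \<open>1 / m k\<close> matters: it makes the coefficients of a model space element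
  \<open>O(sqrt (m k))\<close> and thus summable.
\<close>

lemma atom_norm_square_integral:
  assumes "y > 0"
  shows "(\<integral>x. (cmod (atom k (Complex x y)))\<^sup>2 \<partial>lborel) \<le> 8 * (1 + 2 * mass)\<^sup>2 * pi / m k"
proof -
  let ?C = "8 * (1 + 2 * mass)\<^sup>2"
  have p: "has_bochner_integral lborel (\<lambda>x. ?C * (1 / ((x - real k)\<^sup>2 + (m k)\<^sup>2))) (?C * (pi / m k))"
    by (intro has_bochner_integral_mult_right has_bochner_integral_poisson_kernel m_pos)
  have i: "integrable lborel (\<lambda>x. (cmod (atom k (Complex x y)))\<^sup>2)"
    using tame_hardy2[OF tame_atom] assms hardy2E by metis
  have "(\<integral>x. (cmod (atom k (Complex x y)))\<^sup>2 \<partial>lborel) \<le> (\<integral>x. ?C * (1 / ((x - real k)\<^sup>2 + (m k)\<^sup>2)) \<partial>lborel)"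
    using p i norm_atom_square_le[of "Complex _ y" k] assms
    by (intro integral_mono) (auto simp: has_bochner_integral_iff)
  also have "\<dots> = ?C * (pi / m k)"
    using p by (rule has_bochner_integral_integral_eq)
  finally show ?thesis by simp
qed

text \<open>
  Coefficients for which \<open>norm_atom_le\<close> can be summed term by term. This is more than square summability
  against \<open>1 / m k\<close>, which characterises the model space, but it yields a single decaying majorant.
\<close>

definition admissible :: "(nat \<Rightarrow> complex) \<Rightarrow> bool" where
  "admissible c \<longleftrightarrow> summable (\<lambda>k. cmod (c k) * ((1 + real k) / m k))"

lemma admissible_summable:
  assumes "admissible c"
  shows "summable (\<lambda>k. cmod (c k))"
proof (rule summable_comparison_test')
  show "summable (\<lambda>k. cmod (c k) * ((1 + real k) / m k))"
    using assms by (simp add: admissible_def)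
  show "norm (cmod (c k)) \<le> cmod (c k) * ((1 + real k) / m k)" for k
  proof -
    have "1 \<le> (1 + real k) / m k"
      using m_pos[of k] m_le_1[of k] by (simp add: le_divide_eq)
    from mult_left_mono[OF this, of "cmod (c k)"] show ?thesis by simp
  qed
qed

lemma synth_sums_atoms:
  assumes "summable (\<lambda>k. cmod (c k))"
  shows "(\<lambda>k. c k * atom k z) sums synth c z"
proof (cases "z \<in> upper_half_plane")
  case True
  have "(\<lambda>k. c k / (z - of_nat k)) sums cauchy_sum c z"
    unfolding cauchy_sum_def
    by (intro summable_sums summable_norm_cancel[OF cauchy_sum_upper_half_plane(1)[OF assms True]])
  from sums_divide[OF this, of "herglotz z + \<i>"] show ?thesis
    using True by (simp add: atom_eq synth_def)
qed (simp add: atom_eq synth_def)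

lemma synth_Hol:
  assumes "summable (\<lambda>k. cmod (c k))"
  shows "synth c \<in> Hol"
  unfolding synth_def[abs_def]
  using upper_half_plane_not_Nats
  by (intro Hol_quotient holomorphic_on_subset[OF cauchy_sum_holomorphic[OF assms]]) auto

lemma synth_decay:
  assumes c: "admissible c"
  shows "\<exists>K. \<forall>z\<in>upper_half_plane. cmod (synth c z) \<le> K / (1 + \<bar>Re z\<bar>)"
proof (intro exI ballI)
  fix z assume z: "z \<in> upper_half_plane"
  let ?w = "\<lambda>k. cmod (c k) * ((1 + real k) / m k)"
  let ?q = "4 * (1 + 2 * mass) / (1 + \<bar>Re z\<bar>)"
  have sw: "summable ?w" using c by (simp add: admissible_def)
  have le: "cmod (c k * atom k z) \<le> ?q * ?w k" for k
    using mult_left_mono[OF norm_atom_le[OF z, of k], of "cmod (c k)"] by (simp add: norm_mult mult_ac)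
  have s: "summable (\<lambda>k. cmod (c k * atom k z))"
    by (rule summable_comparison_test'[OF summable_mult[OF sw, of ?q]]) (use le in auto)
  have "cmod (synth c z) = cmod (\<Sum>k. c k * atom k z)"
    using synth_sums_atoms[OF admissible_summable[OF c], of z] by (simp add: sums_iff)
  also have "\<dots> \<le> (\<Sum>k. cmod (c k * atom k z))" by (rule summable_norm[OF s])
  also have "\<dots> \<le> (\<Sum>k. ?q * ?w k)" by (intro suminf_le le s summable_mult sw)
  also have "\<dots> = ?q * (\<Sum>k. ?w k)" by (rule suminf_mult[OF sw])
  also have "\<dots> = (4 * (1 + 2 * mass) * (\<Sum>k. ?w k)) / (1 + \<bar>Re z\<bar>)" by simp
  finally show "cmod (synth c z) \<le> (4 * (1 + 2 * mass) * (\<Sum>k. ?w k)) / (1 + \<bar>Re z\<bar>)" .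
qed

lemma synth_hardy2: "admissible c \<Longrightarrow> synth c \<in> hardy2"
  using synth_decay[of c] synth_Hol[OF admissible_summable] by (blast intro: hardy2I_decay)

lemma synth_tendsto_0_at_infinity:
  assumes c: "admissible c"
  shows "((\<lambda>t. synth c (Complex x t)) \<longlongrightarrow> 0) at_top"
proof (rule Lim_null_comparison)
  show "\<forall>\<^sub>F t in at_top. norm (synth c (Complex x t)) \<le> (\<Sum>k. cmod (c k)) / t"
    using eventually_gt_at_top[of 0]
  proof eventually_elim
    case (elim t)
    then have z: "Complex x t \<in> upper_half_plane" by simp
    note zN = upper_half_planeD[OF z]
    have "cmod (synth c (Complex x t)) = cmod (cauchy_sum c (Complex x t)) / cmod (herglotz (Complex x t) + \<i>)"
      using z by (simp add: synth_def norm_divide)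
    also have "\<dots> \<le> cmod (cauchy_sum c (Complex x t)) / 1"
      using norm_herglotz_plus_i[of "Complex x t"] zN by (intro divide_left_mono) auto
    also have "\<dots> \<le> (\<Sum>k. cmod (c k)) / t"
      using cauchy_sum_upper_half_plane(2)[OF admissible_summable[OF c] z] by simp
    finally show ?case .
  qed
  show "((\<lambda>t. (\<Sum>k. cmod (c k)) / t) \<longlongrightarrow> 0) at_top"
    by (rule real_tendsto_divide_at_top[OF tendsto_const filterlim_ident])
qed

text \<open>
  On the real line \<open>cnj (synth c) * clark_inner = synth (cnj \<circ> c)\<close>, because \<open>herglotz\<close> is real there.
  So up to an L2 error that vanishes at the boundary the pairing of \<open>synth c\<close> with \<open>clark_inner * h\<close>
  is the conjugate of the integral of the product of the Hardy functions \<open>h\<close> and \<open>synth (cnj \<circ> c)\<close>, which is 0.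
\<close>

lemma synth_in_model_space:
  assumes c: "admissible c"
  shows "synth c \<in> model_space clark_inner"
proof -
  let ?c' = "\<lambda>k. cnj (c k)"
  have c': "admissible ?c'" using c by (simp add: admissible_def)
  obtain K where K: "\<And>z. z \<in> upper_half_plane \<Longrightarrow> cmod (synth c z) \<le> K / (1 + \<bar>Re z\<bar>)"
    using synth_decay[OF c] by blast
  obtain K' where K': "\<And>z. z \<in> upper_half_plane \<Longrightarrow> cmod (synth ?c' z) \<le> K' / (1 + \<bar>Re z\<bar>)"
    using synth_decay[OF c'] by blast
  have "hardy_inner (synth c) (pmult clark_inner h) = 0" if h: "h \<in> hardy2" for h
  proof -
    obtain N where N: "N \<ge> 0" "\<And>y. y > 0 \<Longrightarrow> integrable lborel (\<lambda>x. (cmod (h (Complex x y)))\<^sup>2)"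
      "\<And>y. y > 0 \<Longrightarrow> (\<integral>x. (cmod (h (Complex x y)))\<^sup>2 \<partial>lborel) \<le> N"
      using h hardy2E by metis
    define u where "u y x = cnj (synth c (Complex x y)) * clark_inner (Complex x y) - synth ?c' (Complex x y)" for y x
    have meas: "u y \<in> borel_measurable borel" if "y > 0" for y
    proof -
      have [measurable]: "(\<lambda>x. synth c (Complex x y)) \<in> borel_measurable borel"
        "(\<lambda>x. synth ?c' (Complex x y)) \<in> borel_measurable borel"
        "(\<lambda>x. clark_inner (Complex x y)) \<in> borel_measurable borel"
        using that c c' by (auto intro!: Hol_measurable_line synth_Hol admissible_summable clark_inner_Hol)
      show ?thesis unfolding u_def[abs_def] by measurable
    qed
    have ule: "cmod (u y x) \<le> (K + K') / (1 + \<bar>x\<bar>)" if "y > 0" for y x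
    proof -
      have "cmod (u y x) \<le> cmod (synth c (Complex x y)) * cmod (clark_inner (Complex x y)) + cmod (synth ?c' (Complex x y))"
        unfolding u_def by (rule order_trans[OF norm_triangle_ineq4]) (simp add: norm_mult)
      also have "\<dots> \<le> cmod (synth c (Complex x y)) + cmod (synth ?c' (Complex x y))"
        using norm_clark_inner_le_1 by (intro add_right_mono mult_left_le) auto
      also have "\<dots> \<le> K / (1 + \<bar>x\<bar>) + K' / (1 + \<bar>x\<bar>)"
        using K[of "Complex x y"] K'[of "Complex x y"] that by (intro add_mono) auto
      finally show ?thesis by (simp add: add_divide_distrib)
    qed
    have ulim: "AE x in lborel. ((\<lambda>y. u y x) \<longlongrightarrow> 0) (at_right 0)"
      using AE_not_Nats
    proof eventually_elim
      case (elim x)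
      let ?G = "herglotz (of_real x)"
      have "Im ?G = 0" using Im_herglotz_real elim by simp
      then have cG: "cnj ?G = ?G" by (simp add: complex_eq_iff)
      have ne: "?G + \<i> \<noteq> 0" using herglotz_plus_i_nonzero elim by simp
      then have ne': "?G - \<i> \<noteq> 0" using cG
        by (metis complex_cnj_add complex_cnj_i complex_cnj_zero_iff diff_conv_add_uminus)
      have "cnj (cauchy_sum c (of_real x) / (?G + \<i>)) * ((?G - \<i>) / (?G + \<i>))
          = cauchy_sum ?c' (of_real x) / (?G + \<i>)"
        using ne ne' cG cauchy_sum_cnj[OF admissible_summable[OF c] elim] by simp
      moreover have "((\<lambda>y. u y x) \<longlongrightarrow> cnj (cauchy_sum c (of_real x) / (?G + \<i>)) * ((?G - \<i>) / (?G + \<i>))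
          - cauchy_sum ?c' (of_real x) / (?G + \<i>)) (at_right 0)"
        unfolding u_def
        by (intro tendsto_intros vertical_tendsto synth_tendsto clark_inner_tendsto elim
            admissible_summable c c')
      ultimately show ?case by simp
    qed
    have zero: "(\<integral>x. h (Complex x y) * synth ?c' (Complex x y) \<partial>lborel) = 0" if "y > 0" for y
      using hardy2_product_integral_zero[OF h synth_Hol[OF admissible_summable[OF c']] K'
          synth_tendsto_0_at_infinity[OF c'] that] .
    have pair: "(\<integral>x. synth c (Complex x y) * cnj (pmult clark_inner h (Complex x y)) \<partial>lborel)
        = cnj (\<integral>x. u y x * h (Complex x y) \<partial>lborel)"
      and pair_le: "cmod (\<integral>x. u y x * h (Complex x y) \<partial>lborel) \<le> sqrt (\<integral>x. (cmod (u y x))\<^sup>2 \<partial>lborel) * sqrt N" if y: "y > 0" for y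
    proof -
      have [measurable]: "u y \<in> borel_measurable borel" "(\<lambda>x. h (Complex x y)) \<in> borel_measurable borel"
        using meas[OF y] Hol_measurable_line[OF hardy2_Hol[OF h] y] by auto
      have ui: "integrable lborel (\<lambda>x. (cmod (u y x))\<^sup>2)"
      proof (rule Bochner_Integration.integrable_bound[OF integrable_one_over_1_plus_square[of "(K + K')\<^sup>2"]])
        show "AE x in lborel. norm ((cmod (u y x))\<^sup>2) \<le> norm ((K + K')\<^sup>2 / (x\<^sup>2 + 1))"
          using decay_square_le[OF ule[OF y]] by (intro AE_I2) simp
      qed measurable
      note CS = Cauchy_Schwarz_integral[of "u y" lborel "\<lambda>x. h (Complex x y)", OF _ _ ui N(2)[OF y]]
      have i1: "integrable lborel (\<lambda>x. u y x * h (Complex x y))" by (rule CS) measurable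
      have i2: "integrable lborel (\<lambda>x. h (Complex x y) * synth ?c' (Complex x y))"
        by (rule hardy2_pairing(2)[OF h synth_hardy2[OF c'] y y])
      have "(\<integral>x. synth c (Complex x y) * cnj (pmult clark_inner h (Complex x y)) \<partial>lborel)
        = (\<integral>x. cnj (u y x * h (Complex x y) + h (Complex x y) * synth ?c' (Complex x y)) \<partial>lborel)"
        by (intro Bochner_Integration.integral_cong refl) (simp add: u_def pmult_def algebra_simps)
      also have "\<dots> = cnj ((\<integral>x. u y x * h (Complex x y) \<partial>lborel) + (\<integral>x. h (Complex x y) * synth ?c' (Complex x y) \<partial>lborel))"
        by (simp only: Bochner_Integration.integral_add[OF i1 i2, symmetric] Bochner_Integration.integral_cnj)
      finally show "(\<integral>x. synth c (Complex x y) * cnj (pmult clark_inner h (Complex x y)) \<partial>lborel)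
        = cnj (\<integral>x. u y x * h (Complex x y) \<partial>lborel)"
        using zero[OF y] by simp
      have "cmod (\<integral>x. u y x * h (Complex x y) \<partial>lborel) \<le> (\<integral>x. cmod (u y x * h (Complex x y)) \<partial>lborel)"
        by (rule integral_norm_bound)
      also have "\<dots> \<le> sqrt (\<integral>x. (cmod (u y x))\<^sup>2 \<partial>lborel) * sqrt (\<integral>x. (cmod (h (Complex x y)))\<^sup>2 \<partial>lborel)"
        by (rule CS) measurable
      also have "\<dots> \<le> sqrt (\<integral>x. (cmod (u y x))\<^sup>2 \<partial>lborel) * sqrt N"
        using N(3)[OF y] by (intro mult_left_mono) auto
      finally show "cmod (\<integral>x. u y x * h (Complex x y) \<partial>lborel) \<le> sqrt (\<integral>x. (cmod (u y x))\<^sup>2 \<partial>lborel) * sqrt N" .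
    qed
    have "((\<lambda>y. \<integral>x. synth c (Complex x y) * cnj (pmult clark_inner h (Complex x y)) \<partial>lborel) \<longlongrightarrow> 0) (at_right 0)"
    proof (rule tendsto_at_right_sequentially[of 0 1])
      fix S :: "nat \<Rightarrow> real" assume S: "\<And>n. 0 < S n" "S \<longlonglongrightarrow> 0"
      have SF: "filterlim S (at_right 0) sequentially"
        using S by (auto simp: filterlim_at less_imp_neq[symmetric] intro!: always_eventually)
      have "(\<lambda>n. \<integral>x. (cmod (u (S n) x))\<^sup>2 \<partial>lborel) \<longlonglongrightarrow> 0"
      proof (rule dominated_L2_null)
        show "AE x in lborel. (\<lambda>n. u (S n) x) \<longlonglongrightarrow> 0"
          using ulim by eventually_elim (rule filterlim_compose[OF _ SF])
      qed (use S meas ule in auto)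
      then have "(\<lambda>n. sqrt (\<integral>x. (cmod (u (S n) x))\<^sup>2 \<partial>lborel) * sqrt N) \<longlonglongrightarrow> 0"
        using tendsto_real_sqrt[of _ 0 sequentially] by (intro tendsto_mult_left_zero) simp
      then show "(\<lambda>n. \<integral>x. synth c (Complex x (S n)) * cnj (pmult clark_inner h (Complex x (S n))) \<partial>lborel) \<longlonglongrightarrow> 0"
        by (rule Lim_null_comparison[rotated]) (use pair pair_le S in \<open>auto intro!: always_eventually\<close>)
    qed simp
    then show ?thesis
      unfolding hardy_inner_def by (intro tendsto_Lim) auto
  qed
  then show ?thesis
    using synth_hardy2[OF c] by (auto simp: model_space_def)
qed

end

section \<open>Expansion of model space elements\<close>

lemma Cauchy_kernel_decay:
  assumes w: "w \<in> upper_half_plane" and z: "z \<in> upper_half_plane"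
  shows "cmod (1 / (z - cnj w)) \<le> ((1 + \<bar>Re w\<bar>) / Im w + 1) / (1 + \<bar>Re z\<bar>)"
proof -
  define d where "d = cmod (z - cnj w)"
  have b: "Im w > 0" "Im z > 0" using w z by (auto simp: upper_half_plane_def)
  have d1: "Im w \<le> d" unfolding d_def using abs_Im_le_cmod[of "z - cnj w"] b by simp
  have d2: "\<bar>Re z - Re w\<bar> \<le> d" unfolding d_def using abs_Re_le_cmod[of "z - cnj w"] by simp
  have "1 + \<bar>Re z\<bar> \<le> (1 + \<bar>Re w\<bar>) * 1 + d" using d2 by simp
  also have "\<dots> \<le> (1 + \<bar>Re w\<bar>) * (d / Im w) + d"
    using d1 b by (intro add_right_mono mult_left_mono) (auto simp: le_divide_eq)
  also have "\<dots> = ((1 + \<bar>Re w\<bar>) / Im w + 1) * d" by (simp add: distrib_right)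
  finally have "1 + \<bar>Re z\<bar> \<le> ((1 + \<bar>Re w\<bar>) / Im w + 1) * d" .
  moreover have "d > 0" using d1 b by simp
  ultimately have "1 / d \<le> ((1 + \<bar>Re w\<bar>) / Im w + 1) / (1 + \<bar>Re z\<bar>)"
    by (intro one_over_le_divide) auto
  then show ?thesis by (simp add: norm_divide d_def)
qed

context clark_weights
begin

text \<open>
  Up to a factor that depends on \<open>w\<close> only, the sum is the conjugate of the reproducing kernel of the model
  space at \<open>w\<close>. The expansion comes from the partial fraction
  \<open>1 / ((k - w) * (k - cnj z)) = (1 / (k - w) - 1 / (k - cnj z)) / (w - cnj z)\<close>.
\<close>

lemma kernel_sums_atoms:
  assumes z: "z \<in> upper_half_plane" and w: "w \<in> upper_half_plane"
  shows "(\<lambda>k. of_real (m k) / (of_nat k - w) * cnj (atom k z)) sums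
    ((herglotz w + \<i>) * (\<i> / 2) *
      (cnj (1 / (z - cnj w)) - clark_inner w * cnj (clark_inner z * (1 / (z - cnj w)))))"
proof -
  define H where "H = cnj (herglotz z)"
  define G where "G = herglotz w"
  have zw: "cnj z - w \<noteq> 0" "w - cnj z \<noteq> 0"
  proof -
    have "Im (cnj z - w) < 0" "Im (w - cnj z) > 0" using z w by (auto simp: upper_half_plane_def)
    then show "cnj z - w \<noteq> 0" "w - cnj z \<noteq> 0" by auto
  qed
  have Gi: "G + \<i> \<noteq> 0" using herglotz_plus_i_nonzero upper_half_planeD[OF w] by (simp add: G_def)
  have "herglotz z + \<i> \<noteq> 0" using herglotz_plus_i_nonzero upper_half_planeD[OF z] by simp
  then have "cnj (herglotz z + \<i>) \<noteq> 0" by (simp only: complex_cnj_zero_iff not_False_eq_True)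
  then have Hi: "H - \<i> \<noteq> 0" by (simp add: H_def)
  have kw: "of_nat k - w \<noteq> 0" "of_nat k - cnj z \<noteq> 0" "cnj z - of_nat k \<noteq> 0" for k
  proof -
    have "Im (of_nat k - w) \<noteq> 0" "Im (of_nat k - cnj z) \<noteq> 0" "Im (cnj z - of_nat k) \<noteq> 0"
      using z w by (auto simp: upper_half_plane_def)
    then show "of_nat k - w \<noteq> 0" "of_nat k - cnj z \<noteq> 0" "cnj z - of_nat k \<noteq> 0"
      by (metis zero_complex.sel(2))+
  qed
  have "(\<lambda>k. cnj (of_real (m k) / (of_nat k - z))) sums H"
    unfolding H_def sums_cnj using upper_half_planeD[OF z] by (intro herglotz_sums) simp
  then have "(\<lambda>k. of_real (m k) / (of_nat k - cnj z)) sums H" by simp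
  moreover have "(\<lambda>k. of_real (m k) / (of_nat k - w)) sums G"
    unfolding G_def using upper_half_planeD[OF w] by (intro herglotz_sums) simp
  ultimately have "(\<lambda>k. (of_real (m k) / (of_nat k - cnj z) - of_real (m k) / (of_nat k - w)) * (1 / ((w - cnj z) * (H - \<i>))))
      sums ((H - G) * (1 / ((w - cnj z) * (H - \<i>))))"
    by (intro sums_mult2 sums_diff)
  moreover have "(of_real (m k) / (of_nat k - cnj z) - of_real (m k) / (of_nat k - w)) * (1 / ((w - cnj z) * (H - \<i>)))
      = of_real (m k) / (of_nat k - w) * cnj (atom k z)" for k
  proof -
    have pf: "(a / p - a / q) * (1 / ((p - q) * h)) = a / q * (1 / (- p * h))"
      if "p \<noteq> 0" "q \<noteq> 0" "p - q \<noteq> 0" for a p q h :: complex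
    proof -
      have "a / p - a / q = - (a * (p - q)) / (p * q)" using that by (simp add: field_simps)
      then show ?thesis using that by simp
    qed
    have "cnj (atom k z) = 1 / ((cnj z - of_nat k) * (H - \<i>))"
      using z by (simp add: atom_eq H_def)
    then show ?thesis
      using pf[of "of_nat k - cnj z" "of_nat k - w" "of_real (m k)" "H - \<i>"] kw[of k] zw by simp
  qed
  moreover have "(H - G) * (1 / ((w - cnj z) * (H - \<i>))) = (G + \<i>) * (\<i> / 2) *
      (cnj (1 / (z - cnj w)) - clark_inner w * cnj (clark_inner z * (1 / (z - cnj w))))"
  proof -
    have U: "clark_inner w = (G - \<i>) / (G + \<i>)" "cnj (clark_inner z) = (H + \<i>) / (H - \<i>)"
      using z w by (simp_all add: clark_inner_def G_def H_def)
    have "(G + \<i>) * (\<i> / 2) * (1 / (cnj z - w) - (G - \<i>) / (G + \<i>) * ((H + \<i>) / (H - \<i>) * (1 / (cnj z - w))))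
       = \<i> / 2 * ((G + \<i>) * (H - \<i>) - (G - \<i>) * (H + \<i>)) / ((H - \<i>) * (cnj z - w))"
    proof -
      have "e * c * (1 / p - g / e * (h / k * (1 / p))) = c * (e * k - g * h) / (k * p)"
        if "e \<noteq> 0" "k \<noteq> 0" "p \<noteq> 0" for c e g h k p :: complex
        using that by (simp add: field_simps)
      from this[OF Gi Hi zw(1)] show ?thesis .
    qed
    also have "\<i> / 2 * ((G + \<i>) * (H - \<i>) - (G - \<i>) * (H + \<i>)) = - (H - G)"
      by (simp add: algebra_simps)
    also have "- (H - G) / ((H - \<i>) * (cnj z - w)) = (H - G) * (1 / ((w - cnj z) * (H - \<i>)))"
    proof -
      have "- a / (k * p) = a * (1 / (- p * k))" for a k p :: complex by simp
      from this[of "H - G" "H - \<i>" "cnj z - w"] show ?thesis by simp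
    qed
    finally show ?thesis
      by (simp only: complex_cnj_mult complex_cnj_divide complex_cnj_diff complex_cnj_cnj complex_cnj_one U)
  qed
  ultimately show ?thesis by (simp only: G_def)
qed

lemma tame_clark_inner_Cauchy_kernel:
  assumes w: "w \<in> upper_half_plane"
  defines "S \<equiv> \<lambda>z. if z \<in> upper_half_plane then 1 / (z - cnj w) else 0"
  shows "S \<in> hardy2" and "tame (pmult clark_inner S)"
proof -
  have "z - cnj w \<noteq> 0" if "z \<in> upper_half_plane" for z
  proof -
    have "Im (z - cnj w) > 0" using that w by (simp add: upper_half_plane_def)
    then show ?thesis by auto
  qed
  then have "(\<lambda>z. 1 / (z - cnj w)) holomorphic_on upper_half_plane"
    by (intro holomorphic_intros)
  then have hol: "S holomorphic_on upper_half_plane"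
    unfolding S_def by (rule holomorphic_transform) simp
  then have SH: "S \<in> Hol" by (simp add: Hol_def S_def)
  show S: "S \<in> hardy2"
    by (rule hardy2I_decay[OF SH]) (use Cauchy_kernel_decay[OF w] in \<open>simp add: S_def\<close>)
  show "tame (pmult clark_inner S)"
    unfolding tame_def
  proof (intro conjI exI ballI)
    have "(\<lambda>z. clark_inner z * S z) holomorphic_on upper_half_plane"
      using hol clark_inner_Hol by (intro holomorphic_intros) (auto simp: Hol_def)
    then show "pmult clark_inner S \<in> Hol"
      by (simp add: Hol_def pmult_def S_def)
    show "cmod (pmult clark_inner S z) \<le> ((1 + \<bar>Re w\<bar>) / Im w + 1) / (1 + \<bar>Re z\<bar>)" if z: "z \<in> upper_half_plane" for z
    proof -
      have "cmod (pmult clark_inner S z) \<le> cmod (S z)"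
        unfolding pmult_def norm_mult using norm_clark_inner_le_1[of z] by (intro mult_left_le_one_le) auto
      also have "\<dots> \<le> ((1 + \<bar>Re w\<bar>) / Im w + 1) / (1 + \<bar>Re z\<bar>)"
        using Cauchy_kernel_decay[OF w z] z by (simp add: S_def)
      finally show ?thesis .
    qed
    show "AE x in lborel. \<exists>l. ((\<lambda>y. pmult clark_inner S (Complex x y)) \<longlongrightarrow> l) (at_right 0)"
      using AE_not_Nats
    proof eventually_elim
      case (elim x)
      have "of_real x - cnj w \<noteq> 0"
      proof
        assume "of_real x - cnj w = 0"
        from arg_cong[OF this, of Im] show False using w by (simp add: upper_half_plane_def)
      qed
      then have "((\<lambda>z. 1 / (z - cnj w)) \<longlongrightarrow> 1 / (of_real x - cnj w)) (at (of_real x) within upper_half_plane)"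
        by (intro tendsto_intros)
      then have "(S \<longlongrightarrow> 1 / (of_real x - cnj w)) (at (of_real x) within upper_half_plane)"
        by (rule Lim_transform_eventually) (simp add: eventually_at_filter S_def)
      from tendsto_mult[OF vertical_tendsto[OF clark_inner_tendsto[OF elim]] vertical_tendsto[OF this]]
      show ?case unfolding pmult_def by blast
    qed
  qed
qed

text \<open>
  Pairing \<open>f\<close> at height \<open>y\<close> with the kernel expansion expresses the value of \<open>f\<close> near \<open>w\<close> through the pairings
  of \<open>f\<close> with the atoms. As \<open>y\<close> tends to 0 the term with \<open>clark_inner\<close> disappears because \<open>f\<close> is orthogonal to the
  multiples of \<open>clark_inner\<close>, and what remains is the claimed expansion at \<open>w\<close>.
\<close>

lemma model_space_imp_synth:
  assumes f: "f \<in> model_space clark_inner"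
  shows "\<exists>c K. (\<forall>k. cmod (c k) \<le> K * sqrt (m k)) \<and> f = synth c"
proof -
  have fH: "f \<in> hardy2" and orth: "\<And>h. h \<in> hardy2 \<Longrightarrow> hardy_inner f (pmult clark_inner h) = 0"
    using f by (auto simp: model_space_def)
  obtain N where N: "N \<ge> 0" "\<And>y. y > 0 \<Longrightarrow> integrable lborel (\<lambda>x. (cmod (f (Complex x y)))\<^sup>2)"
    "\<And>y. y > 0 \<Longrightarrow> (\<integral>x. (cmod (f (Complex x y)))\<^sup>2 \<partial>lborel) \<le> N"
    using fH hardy2E by metis
  have f0: "f z = 0" if "z \<notin> upper_half_plane" for z
    using hardy2_Hol[OF fH] that by (simp add: Hol_def)
  define I where "I k y = (\<integral>x. f (Complex x y) * cnj (atom k (Complex x y)) \<partial>lborel)" for k y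
  define D where "D = sqrt N * sqrt (8 * (1 + 2 * mass)\<^sup>2 * pi)"
  have norm_I: "(\<integral>x. cmod (f (Complex x y) * cnj (atom k (Complex x y))) \<partial>lborel) \<le> D / sqrt (m k)"
    if "y > 0" for k y
  proof -
    have "(\<integral>x. cmod (f (Complex x y) * cnj (atom k (Complex x y))) \<partial>lborel)
       \<le> sqrt N * sqrt (8 * (1 + 2 * mass)\<^sup>2 * pi / m k)"
      using N(1) N(3)[OF that] atom_norm_square_integral[OF that]
      by (intro order_trans[OF hardy2_pairing(3)[OF fH tame_hardy2[OF tame_atom] that that]] mult_mono) auto
    then show ?thesis by (simp add: D_def real_sqrt_divide)
  qed
  have I_bound: "cmod (I k y) \<le> D / sqrt (m k)" for k y
  proof (cases "y > 0")
    case True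
    have "cmod (I k y) \<le> (\<integral>x. cmod (f (Complex x y) * cnj (atom k (Complex x y))) \<partial>lborel)"
      unfolding I_def by (rule integral_norm_bound)
    with norm_I[OF True, of k] show ?thesis by linarith
  next
    case False
    then have "I k y = 0" by (simp add: I_def f0)
    then show ?thesis using m_pos[of k] N by (simp add: D_def)
  qed
  have "\<exists>L. (I k \<longlongrightarrow> L) (at_right 0)" for k
    unfolding I_def[abs_def] by (rule hardy2_tame_pairing_converges[OF fH tame_atom])
  then obtain L where L: "\<And>k. (I k \<longlongrightarrow> L k) (at_right 0)" by metis
  have L_bound: "cmod (L k) \<le> D / sqrt (m k)" for k
    by (rule Lim_norm_ubound[OF _ L]) (auto simp: I_bound)
  define c where "c k = of_real (m k / pi) * L k" for k
  have c_bound: "cmod (c k) \<le> D / pi * sqrt (m k)" for k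
  proof -
    have "cmod (c k) = m k / pi * cmod (L k)"
      using m_pos[of k] by (simp add: c_def norm_mult norm_divide)
    also have "\<dots> \<le> m k / pi * (D / sqrt (m k))"
      using m_pos[of k] by (intro mult_left_mono L_bound) auto
    also have "\<dots> = D / pi * (m k / sqrt (m k))" by simp
    also have "m k / sqrt (m k) = sqrt (m k)" using m_pos[of k] by (simp add: real_div_sqrt)
    finally show ?thesis .
  qed
  have sc: "summable (\<lambda>k. cmod (c k))"
    by (rule summable_comparison_test'[OF summable_mult[OF summable_sqrt_m, of "D / pi"]]) (use c_bound in auto)
  have "f w = synth c w" if w: "w \<in> upper_half_plane" for w
  proof -
    have Imw: "Im w > 0" using w by (simp add: upper_half_plane_def)
    have Gi: "herglotz w + \<i> \<noteq> 0" using herglotz_plus_i_nonzero upper_half_planeD[OF w] by simp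
    define S where "S = (\<lambda>z. if z \<in> upper_half_plane then 1 / (z - cnj w) else 0)"
    have S: "S \<in> hardy2" "tame (pmult clark_inner S)"
      unfolding S_def by (rule tame_clark_inner_Cauchy_kernel[OF w])+
    define J where "J y = (\<integral>x. f (Complex x y) * cnj (pmult clark_inner S (Complex x y)) \<partial>lborel)" for y
    have J: "(J \<longlongrightarrow> 0) (at_right 0)"
    proof -
      obtain l where l: "(J \<longlongrightarrow> l) (at_right 0)"
        using hardy2_tame_pairing_converges[OF fH S(2)] unfolding J_def[abs_def] by blast
      then have "Lim (at_right 0) J = l" by (intro tendsto_Lim) auto
      moreover have "Lim (at_right 0) J = 0"
        using orth[OF S(1)] unfolding hardy_inner_def J_def[abs_def] .
      ultimately show ?thesis using l by simp
    qed
    define b where "b k = of_real (m k) / (of_nat k - w)" for k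
    have b_le: "cmod (b k) \<le> m k / Im w" for k
      unfolding b_def norm_divide using Im_le_dist_of_nat[of w k] Imw m_pos[of k]
      by (subst norm_minus_commute) (auto intro!: divide_left_mono mult_pos_pos)
    define M where "M k = D / Im w * sqrt (m k)" for k
    have sM: "summable M" unfolding M_def by (intro summable_mult summable_sqrt_m)
    have b_M: "cmod (b k) * (D / sqrt (m k)) \<le> M k" for k
    proof -
      have "cmod (b k) * (D / sqrt (m k)) \<le> m k / Im w * (D / sqrt (m k))"
        using m_pos[of k] N by (intro mult_right_mono b_le) (simp add: D_def)
      also have "\<dots> = D / Im w * (m k / sqrt (m k))" by simp
      also have "m k / sqrt (m k) = sqrt (m k)" using m_pos[of k] by (simp add: real_div_sqrt)
      finally show ?thesis by (simp add: M_def)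
    qed
    have expansion: "(\<Sum>k. b k * I k y) = (herglotz w + \<i>) * (\<i> / 2) *
        (2 * pi * \<i> * f (w + 2 * \<i> * of_real y) - clark_inner w * J y)" if y: "y > 0" for y
    proof -
      let ?\<phi> = "\<lambda>k x. b k * (f (Complex x y) * cnj (atom k (Complex x y)))"
      have i: "integrable lborel (?\<phi> k)" for k
        by (intro integrable_mult_right hardy2_pairing(1) fH tame_hardy2 tame_atom y)
      have pointwise: "(\<lambda>k. ?\<phi> k x) sums (f (Complex x y) * ((herglotz w + \<i>) * (\<i> / 2) *
        (cnj (S (Complex x y)) - clark_inner w * cnj (pmult clark_inner S (Complex x y)))))" for x
        using sums_mult[OF kernel_sums_atoms[of "Complex x y" w], of "f (Complex x y)"] y w
        by (simp add: b_def S_def pmult_def mult_ac)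
      have "(\<Sum>k. integral\<^sup>L lborel (?\<phi> k)) = (\<integral>x. (\<Sum>k. ?\<phi> k x) \<partial>lborel)"
      proof (rule integral_suminf[OF i, symmetric])
        show "AE x in lborel. summable (\<lambda>k. norm (?\<phi> k x))"
        proof (intro AE_I2, rule summable_comparison_test')
          show "summable (\<lambda>k. m k * (1 / Im w * (cmod (f (Complex x y)) * (1 / y))))" for x
            by (intro summable_mult2 summable_m)
        next
          fix x k
          let ?z = "Complex x y"
          have z: "?z \<in> upper_half_plane" using y by simp
          have "cmod (atom k ?z) = 1 / (cmod (?z - of_nat k) * cmod (herglotz ?z + \<i>))"
            using z by (simp add: atom_eq norm_divide norm_mult)
          also have "\<dots> \<le> 1 / (y * 1)"
            using norm_herglotz_plus_i[of ?z] upper_half_planeD[OF z] Im_le_dist_of_nat[of ?z k] y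
            by (intro divide_left_mono mult_mono mult_pos_pos) auto
          finally have "cmod (atom k ?z) \<le> 1 / y" by simp
          then have "cmod (b k) * (cmod (f ?z) * cmod (atom k ?z)) \<le> m k / Im w * (cmod (f ?z) * (1 / y))"
            using m_pos[of k] Imw by (intro mult_mono b_le mult_left_mono) auto
          then show "norm (norm (?\<phi> k x)) \<le> m k * (1 / Im w * (cmod (f ?z) * (1 / y)))"
            by (simp add: norm_mult)
        qed
        show "summable (\<lambda>k. \<integral>x. norm (?\<phi> k x) \<partial>lborel)"
        proof (rule summable_comparison_test'[OF sM])
          fix k
          have "(\<integral>x. norm (?\<phi> k x) \<partial>lborel) = cmod (b k) * (\<integral>x. cmod (f (Complex x y) * cnj (atom k (Complex x y))) \<partial>lborel)"
            by (simp only: norm_mult[of "b k"] integral_mult_right_zero)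
          also have "\<dots> \<le> cmod (b k) * (D / sqrt (m k))"
            by (intro mult_left_mono norm_I y) simp
          also note b_M
          finally show "norm (\<integral>x. norm (?\<phi> k x) \<partial>lborel) \<le> M k"
            by simp
        qed
      qed
      also have "\<dots> = (\<integral>x. (herglotz w + \<i>) * (\<i> / 2) * (f (Complex x y) * cnj (S (Complex x y))
           - clark_inner w * (f (Complex x y) * cnj (pmult clark_inner S (Complex x y)))) \<partial>lborel)"
      proof (intro Bochner_Integration.integral_cong refl)
        fix x
        have alg: "a * (p * (q - u * r)) = p * (a * q - u * (a * r))" for a p q u r :: complex
          by (simp add: algebra_simps)
        show "(\<Sum>k. ?\<phi> k x) = (herglotz w + \<i>) * (\<i> / 2) * (f (Complex x y) * cnj (S (Complex x y))
           - clark_inner w * (f (Complex x y) * cnj (pmult clark_inner S (Complex x y))))"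
          unfolding sums_unique[OF pointwise, symmetric] by (rule alg)
      qed
      also have "\<dots> = (herglotz w + \<i>) * (\<i> / 2) * ((\<integral>x. f (Complex x y) * cnj (S (Complex x y)) \<partial>lborel) - clark_inner w * J y)"
        unfolding J_def
        by (simp only: integral_mult_right_zero Bochner_Integration.integral_diff[OF hardy2_pairing(1)[OF fH S(1) y y]
              integrable_mult_right[OF hardy2_pairing(1)[OF fH tame_hardy2[OF S(2)] y y]]])
      also have "(\<integral>x. f (Complex x y) * cnj (S (Complex x y)) \<partial>lborel) = 2 * pi * \<i> * f (w + 2 * \<i> * of_real y)"
      proof -
        \<comment> \<open>On the line at height \<open>y\<close> conjugation is a translation: \<open>cnj z = z - 2 * \<i> * y\<close>.\<close>
        have "cnj (S (Complex x y)) = 1 / (Complex x y - (w + 2 * \<i> * of_real y))" for x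
        proof -
          have "cnj (Complex x y) - w = Complex x y - (w + 2 * \<i> * of_real y)" by (simp add: complex_eq_iff)
          then show ?thesis using y by (simp add: S_def)
        qed
        then show ?thesis
          using hardy2_Cauchy_formula[OF fH y, of "w + 2 * \<i> * of_real y"] Imw y by simp
      qed
      finally show ?thesis by (simp add: I_def)
    qed
    have "((\<lambda>y. \<Sum>k. b k * I k y) \<longlongrightarrow> (\<Sum>k. b k * L k)) (at_right 0)"
    proof -
      have "cmod (b k * I k y) \<le> M k" for k y
        unfolding norm_mult by (rule order_trans[OF mult_left_mono[OF I_bound] b_M]) simp
      then show ?thesis
        using tannerys_theorem[of "\<lambda>k y. b k * I k y" "\<lambda>k. b k * L k" "at_right 0" M] L sM
        by (auto intro!: tendsto_mult_left always_eventually)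
    qed
    moreover have "((\<lambda>y. \<Sum>k. b k * I k y) \<longlongrightarrow> (herglotz w + \<i>) * (\<i> / 2) * (2 * pi * \<i> * f w - clark_inner w * 0)) (at_right 0)"
    proof (rule Lim_transform_eventually)
      have "continuous_on upper_half_plane f"
        using hardy2_Hol[OF fH] by (auto simp: Hol_def intro: holomorphic_on_imp_continuous_on)
      then have "isCont f w"
        using w open_upper_half_plane continuous_on_eq_continuous_at by blast
      moreover have "((\<lambda>y. w + 2 * \<i> * of_real y) \<longlongrightarrow> w) (at_right 0)"
        by (auto intro!: tendsto_eq_intros)
      ultimately have "((\<lambda>y. f (w + 2 * \<i> * of_real y)) \<longlongrightarrow> f w) (at_right 0)"
        by (rule isCont_tendsto_compose)
      then show "((\<lambda>y. (herglotz w + \<i>) * (\<i> / 2) * (2 * pi * \<i> * f (w + 2 * \<i> * of_real y) - clark_inner w * J y))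
         \<longlongrightarrow> (herglotz w + \<i>) * (\<i> / 2) * (2 * pi * \<i> * f w - clark_inner w * 0)) (at_right 0)"
        by (intro tendsto_intros J)
      show "\<forall>\<^sub>F y in at_right 0. (herglotz w + \<i>) * (\<i> / 2) * (2 * pi * \<i> * f (w + 2 * \<i> * of_real y) - clark_inner w * J y)
          = (\<Sum>k. b k * I k y)"
        using eventually_at_right_less[of 0] by eventually_elim (simp add: expansion)
    qed
    ultimately have "(\<Sum>k. b k * L k) = (herglotz w + \<i>) * (\<i> / 2) * (2 * pi * \<i> * f w - clark_inner w * 0)"
      by (intro tendsto_unique[of "at_right (0::real)"]) auto
    also have "\<dots> = - pi * ((herglotz w + \<i>) * f w)"
    proof -
      have "p * (j / 2) * (2 * q * j * r - u * 0) = (j * j) * (q * (p * r))" for j p q r u :: complex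
        by (simp add: mult_ac)
      from this[where j = \<i>] show ?thesis by simp
    qed
    finally have eq: "(\<Sum>k. b k * L k) = - pi * ((herglotz w + \<i>) * f w)" .
    have "(\<lambda>k. c k / (w - of_nat k)) sums cauchy_sum c w"
      unfolding cauchy_sum_def
      by (intro summable_sums summable_norm_cancel[OF cauchy_sum_upper_half_plane(1)[OF sc w]])
    from sums_mult[OF this, of "- of_real pi"]
    have "(\<lambda>k. - of_real pi * (c k / (w - of_nat k))) sums (- of_real pi * cauchy_sum c w)" .
    moreover have "- of_real pi * (c k / (w - of_nat k)) = b k * L k" for k
    proof -
      have "w - of_nat k = - (of_nat k - w)" by simp
      then show ?thesis by (simp only: c_def b_def divide_minus_right) simp
    qed
    ultimately have "(\<Sum>k. b k * L k) = - pi * cauchy_sum c w"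
      by (simp add: sums_iff)
    with eq have "(herglotz w + \<i>) * f w = cauchy_sum c w" by simp
    then show ?thesis
      using w Gi by (simp add: synth_def field_simps)
  qed
  then have "f = synth c"
    using f0 by (auto simp: fun_eq_iff synth_def)
  with c_bound show ?thesis by blast
qed

end

section \<open>Multipliers between two model spaces on the same points\<close>

text \<open>
  Two weight sequences on the same points. The comparison makes the coefficients of the first model space,
  which are of size \<open>sqrt (m1 k)\<close>, admissible for the second.
\<close>

locale clark_pair = B: clark_weights m1 + T: clark_weights m2 for m1 m2 :: "nat \<Rightarrow> real" +
  assumes comparison: "summable (\<lambda>k. sqrt (m1 k) * ((1 + real k) / m2 k))"
begin

definition \<Psi> :: "complex \<Rightarrow> complex" where
  "\<Psi> z = (if z \<in> upper_half_plane then (B.herglotz z + \<i>) / (T.herglotz z + \<i>) else 0)"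

lemma Psi_Hol: "\<Psi> \<in> Hol"
  unfolding \<Psi>_def[abs_def]
  using upper_half_plane_not_Nats
  by (intro T.Hol_quotient holomorphic_intros holomorphic_on_subset[OF B.herglotz_holomorphic]) auto

lemma Psi_nonzero: "z \<in> upper_half_plane \<Longrightarrow> \<Psi> z \<noteq> 0"
  using B.herglotz_plus_i_nonzero T.herglotz_plus_i_nonzero upper_half_planeD[of z]
  by (simp add: \<Psi>_def)

lemma Psi_times_synth:
  assumes "summable (\<lambda>k. cmod (c k))"
  shows "pmult (\<lambda>z. a * \<Psi> z) (B.synth c) = T.synth (\<lambda>k. a * c k)"
proof
  fix z
  show "pmult (\<lambda>z. a * \<Psi> z) (B.synth c) z = T.synth (\<lambda>k. a * c k) z"
  proof (cases "z \<in> upper_half_plane")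
    case True
    have "B.herglotz z + \<i> \<noteq> 0" using B.herglotz_plus_i_nonzero upper_half_planeD[OF True] by simp
    then show ?thesis
      using True by (simp add: pmult_def \<Psi>_def B.synth_def T.synth_def cauchy_sum_cmult[OF assms True])
  qed (simp add: pmult_def B.synth_def T.synth_def)
qed

lemma first_coefficients_admissible:
  assumes c: "\<And>k. cmod (c k) \<le> K * sqrt (m1 k)"
  shows "T.admissible (\<lambda>k. a * c k)"
  unfolding T.admissible_def
proof (rule summable_comparison_test'[OF summable_mult[OF comparison, of "cmod a * K"]])
  fix k
  have "cmod (a * c k) * ((1 + real k) / m2 k) \<le> cmod a * (K * sqrt (m1 k)) * ((1 + real k) / m2 k)"
    unfolding norm_mult using T.m_pos[of k] by (intro mult_right_mono mult_left_mono c) auto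
  then show "norm (cmod (a * c k) * ((1 + real k) / m2 k)) \<le> cmod a * K * (sqrt (m1 k) * ((1 + real k) / m2 k))"
    using T.m_pos[of k] by (simp add: mult_ac)
qed

lemma scaled_Psi_maps:
  "pmult (\<lambda>z. a * \<Psi> z) ` model_space B.clark_inner \<subseteq> model_space T.clark_inner"
proof
  fix g assume "g \<in> pmult (\<lambda>z. a * \<Psi> z) ` model_space B.clark_inner"
  then obtain f where f: "f \<in> model_space B.clark_inner" "g = pmult (\<lambda>z. a * \<Psi> z) f" by blast
  obtain c K where c: "\<And>k. cmod (c k) \<le> K * sqrt (m1 k)" "f = B.synth c"
    using B.model_space_imp_synth[OF f(1)] by blast
  have "summable (\<lambda>k. cmod (c k))"
    by (rule summable_comparison_test'[OF summable_mult[OF B.summable_sqrt_m, of K]]) (use c in auto)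
  then have "g = T.synth (\<lambda>k. a * c k)"
    unfolding f(2) c(2) by (rule Psi_times_synth)
  then show "g \<in> model_space T.clark_inner"
    using T.synth_in_model_space[OF first_coefficients_admissible[OF c(1)]] by simp
qed

text \<open>
  Let \<open>\<phi> = \<Phi> / \<Psi>\<close>. Applying the multiplier to the atom at \<open>n\<close> shows \<open>\<phi> z = (z - n) * cauchy_sum (d n) z\<close> for every \<open>n\<close>.
  The residue of this function at \<open>n\<close> is 0 by the formula for \<open>n\<close> itself and \<open>n * d 0 n\<close> by the formula for 0.
  So \<open>d 0\<close> is supported at 0, which makes \<open>\<phi>\<close> constant.
\<close>

lemma multiplier_imp_const_multiple:
  assumes \<Phi>: "\<Phi> \<in> multipliers B.clark_inner T.clark_inner"
  shows "\<Phi> \<in> const_multiples \<Psi>"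
proof -
  have hol: "\<Phi> \<in> Hol" and maps: "pmult \<Phi> ` model_space B.clark_inner \<subseteq> model_space T.clark_inner"
    using \<Phi> by (auto simp: multipliers_def)
  have "\<exists>d. summable (\<lambda>k. cmod (d k)) \<and> pmult \<Phi> (B.atom n) = T.synth d" for n
  proof -
    have "B.admissible (\<lambda>j. if j = n then 1 else 0)"
      unfolding B.admissible_def by (rule summable_finite[of "{n}"]) auto
    from B.synth_in_model_space[OF this] have "B.atom n \<in> model_space B.clark_inner"
      by (simp add: B.atom_def)
    with maps have "pmult \<Phi> (B.atom n) \<in> model_space T.clark_inner" by blast
    from T.model_space_imp_synth[OF this] obtain d K
      where d: "\<And>k. cmod (d k) \<le> K * sqrt (m2 k)" "pmult \<Phi> (B.atom n) = T.synth d" by blast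
    have "summable (\<lambda>k. cmod (d k))"
      by (rule summable_comparison_test'[OF summable_mult[OF T.summable_sqrt_m, of K]]) (use d in auto)
    with d(2) show ?thesis by blast
  qed
  then obtain d where d: "\<And>n. summable (\<lambda>k. cmod (d n k))" "\<And>n. pmult \<Phi> (B.atom n) = T.synth (d n)"
    by metis
  define \<phi> where "\<phi> z = \<Phi> z * (T.herglotz z + \<i>) / (B.herglotz z + \<i>)" for z
  have phi: "\<phi> z = (z - of_nat n) * cauchy_sum (d n) z" if z: "z \<in> upper_half_plane" for z n
  proof -
    have ne: "B.herglotz z + \<i> \<noteq> 0" "T.herglotz z + \<i> \<noteq> 0"
      using B.herglotz_plus_i_nonzero T.herglotz_plus_i_nonzero upper_half_planeD[OF z] by auto
    have zn: "z - of_nat n \<noteq> 0" using upper_half_planeD[OF z] by auto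
    have "\<Phi> z * (1 / ((z - of_nat n) * (B.herglotz z + \<i>))) = cauchy_sum (d n) z / (T.herglotz z + \<i>)"
      using fun_cong[OF d(2)[of n], of z] z by (simp add: pmult_def B.atom_eq T.synth_def)
    moreover have "F * b / a = p * s" if "F * (1 / (p * a)) = s / b" "p \<noteq> 0" "a \<noteq> 0" "b \<noteq> 0" for F a b p s :: complex
      using that by (simp add: field_simps)
    ultimately show ?thesis unfolding \<phi>_def using ne zn by blast
  qed
  \<comment> \<open>Both formulas for \<open>\<phi>\<close>, multiplied by \<open>\<i> * y\<close>, as \<open>y\<close> tends to 0 at \<open>n + \<i> * y\<close>.\<close>
  have zero: "d 0 n = 0" if "n \<noteq> 0" for n
  proof -
    let ?z = "\<lambda>y. of_nat n + \<i> * complex_of_real y"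
    have "((\<lambda>y. ?z y * (\<i> * of_real y * cauchy_sum (d 0) (?z y))) \<longlongrightarrow> (of_nat n + \<i> * of_real 0) * d 0 n) (at_right 0)"
      by (intro tendsto_intros cauchy_sum_residue d)
    moreover have "((\<lambda>y. ?z y * (\<i> * of_real y * cauchy_sum (d 0) (?z y))) \<longlongrightarrow> \<i> * of_real 0 * d n n) (at_right 0)"
    proof (rule Lim_transform_eventually)
      show "((\<lambda>y. \<i> * of_real y * (\<i> * of_real y * cauchy_sum (d n) (?z y))) \<longlongrightarrow> \<i> * of_real 0 * d n n) (at_right 0)"
        by (intro tendsto_intros cauchy_sum_residue d)
      show "\<forall>\<^sub>F y in at_right 0. \<i> * of_real y * (\<i> * of_real y * cauchy_sum (d n) (?z y))
          = ?z y * (\<i> * of_real y * cauchy_sum (d 0) (?z y))"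
        using eventually_at_right_less[of 0]
      proof eventually_elim
        case (elim y)
        then have z: "?z y \<in> upper_half_plane" by (simp add: upper_half_plane_def)
        have "\<i> * of_real y * cauchy_sum (d n) (?z y) = ?z y * cauchy_sum (d 0) (?z y)"
          using phi[OF z, of n] phi[OF z, of 0] by simp
        then show ?case by (simp only: mult_ac)
      qed
    qed
    ultimately have "(of_nat n + \<i> * of_real 0) * d 0 n = \<i> * of_real 0 * d n n"
      by (intro tendsto_unique[of "at_right (0::real)"]) auto
    then show ?thesis using that by simp
  qed
  have "d 0 = (\<lambda>k. if k = 0 then d 0 0 else 0)"
    using zero by auto
  then have cs: "cauchy_sum (d 0) z = d 0 0 / (z - of_nat 0)" for z
    using cauchy_sum_single[of 0 "d 0 0" z] by simp
  have "\<Phi> z = d 0 0 * \<Psi> z" for z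
  proof (cases "z \<in> upper_half_plane")
    case True
    have ne: "B.herglotz z + \<i> \<noteq> 0" "T.herglotz z + \<i> \<noteq> 0" "z \<noteq> 0"
      using B.herglotz_plus_i_nonzero T.herglotz_plus_i_nonzero upper_half_planeD[OF True] by auto
    have "\<phi> z = d 0 0"
      using phi[OF True, of 0] cs[of z] ne(3) by simp
    then show ?thesis
      using True ne by (simp add: \<phi>_def \<Psi>_def field_simps)
  next
    case False
    then show ?thesis using hol by (simp add: Hol_def \<Psi>_def)
  qed
  then show ?thesis
    unfolding const_multiples_def by (auto simp: fun_eq_iff)
qed

lemma multipliers_eq: "multipliers B.clark_inner T.clark_inner = const_multiples \<Psi>"
proof
  show "multipliers B.clark_inner T.clark_inner \<subseteq> const_multiples \<Psi>"
    using multiplier_imp_const_multiple by blast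
  show "const_multiples \<Psi> \<subseteq> multipliers B.clark_inner T.clark_inner"
  proof
    fix \<Phi> assume "\<Phi> \<in> const_multiples \<Psi>"
    then obtain a where a: "\<Phi> = (\<lambda>z. a * \<Psi> z)" by (auto simp: const_multiples_def)
    have "\<Phi> \<in> Hol"
      using Psi_Hol unfolding a by (auto simp: Hol_def intro!: holomorphic_intros)
    then show "\<Phi> \<in> multipliers B.clark_inner T.clark_inner"
      using scaled_Psi_maps[of a] by (simp add: multipliers_def a)
  qed
qed

text \<open>
  The coefficients of an element of a model space are determined by it, so coefficients that are too large for the
  first space give an element of the second one outside the image.
\<close>

lemma Psi_image_proper:
  assumes e: "T.admissible e" and large: "\<And>K. \<exists>k. K * sqrt (m1 k) < cmod (e k)"
  shows "pmult \<Psi> ` model_space B.clark_inner \<subset> model_space T.clark_inner"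
proof
  show "pmult \<Psi> ` model_space B.clark_inner \<subseteq> model_space T.clark_inner"
    using scaled_Psi_maps[of 1] by simp
  have "T.synth e \<notin> pmult \<Psi> ` model_space B.clark_inner"
  proof
    assume "T.synth e \<in> pmult \<Psi> ` model_space B.clark_inner"
    then obtain f where f: "f \<in> model_space B.clark_inner" "T.synth e = pmult \<Psi> f" by blast
    obtain c K where c: "\<And>k. cmod (c k) \<le> K * sqrt (m1 k)" "f = B.synth c"
      using B.model_space_imp_synth[OF f(1)] by blast
    have sc: "summable (\<lambda>k. cmod (c k))"
      by (rule summable_comparison_test'[OF summable_mult[OF B.summable_sqrt_m, of K]]) (use c in auto)
    have eq: "T.synth e = T.synth c"
      using f(2) Psi_times_synth[OF sc, of 1] by (simp add: c(2))
    have "e = c"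
    proof (rule cauchy_sum_unique[OF T.admissible_summable[OF e] sc])
      fix z assume z: "z \<in> upper_half_plane"
      have "T.herglotz z + \<i> \<noteq> 0" using T.herglotz_plus_i_nonzero upper_half_planeD[OF z] by simp
      then show "cauchy_sum e z = cauchy_sum c z"
        using fun_cong[OF eq, of z] z by (simp add: T.synth_def)
    qed
    moreover obtain k where "K * sqrt (m1 k) < cmod (e k)" using large by blast
    ultimately show False using c(1)[of k] by simp
  qed
  moreover have "T.synth e \<in> model_space T.clark_inner"
    using e by (rule T.synth_in_model_space)
  ultimately show "pmult \<Psi> ` model_space B.clark_inner \<noteq> model_space T.clark_inner" by blast
qed

end

lemma summable_linear_geometric:
  fixes q :: real
  assumes "0 \<le> q" "q < 1 / 2"
  shows "summable (\<lambda>k. (1 + real k) * q ^ k)"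
proof (rule summable_comparison_test')
  show "summable (\<lambda>k. (2 * q) ^ k)" using assms by (intro summable_geometric) simp
  show "norm ((1 + real k) * q ^ k) \<le> (2 * q) ^ k" for k
  proof -
    have "Suc k \<le> 2 ^ k" by (simp add: Suc_leI)
    then have "real (Suc k) \<le> real (2 ^ k)" by (rule of_nat_mono)
    then have "(1 + real k) * q ^ k \<le> 2 ^ k * q ^ k"
      using assms by (intro mult_right_mono) auto
    then show ?thesis using assms by (simp add: power_mult_distrib)
  qed
qed

lemma clark_weights_geometric:
  assumes "0 < q" "q < 1"
  shows "clark_weights (\<lambda>k. (q\<^sup>2) ^ k)"
proof
  show "(q\<^sup>2) ^ k > 0" "(q\<^sup>2) ^ k \<le> 1" for k
    using assms by (auto intro!: power_le_one)
  have "sqrt ((q\<^sup>2) ^ k) = q ^ k" for k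
    using assms by (simp add: real_sqrt_power)
  then show "summable (\<lambda>k. sqrt ((q\<^sup>2) ^ k))"
    using assms by (simp add: summable_geometric)
qed

theorem theorem6p14:
  shows "\<exists>B \<Theta> \<Psi>. inner_function B \<and> inner_function \<Theta> \<and>
           \<Psi> \<in> Hol \<and> (\<exists>z\<in>upper_half_plane. \<Psi> z \<noteq> 0) \<and>
           multipliers B \<Theta> = const_multiples \<Psi> \<and>
           pmult \<Psi> ` model_space B \<subset> model_space \<Theta>"
proof -
  define m1 m2 :: "nat \<Rightarrow> real" where "m1 k = ((1/16)\<^sup>2) ^ k" and "m2 k = ((1/2)\<^sup>2) ^ k" for k
  have m2_inverse: "x ^ k * ((1 + real k) / m2 k) = (1 + real k) * (4 * x) ^ k" for x k
    by (simp add: m2_def power_divide power_mult_distrib)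
  have sqrt_m1: "sqrt (m1 k) = (1/16) ^ k" for k
    by (simp add: m1_def real_sqrt_power)
  interpret P: clark_pair m1 m2
  proof (intro clark_pair.intro clark_pair_axioms.intro)
    show "clark_weights m1" "clark_weights m2"
      unfolding m1_def[abs_def] m2_def[abs_def] by (intro clark_weights_geometric; simp)+
    show "summable (\<lambda>k. sqrt (m1 k) * ((1 + real k) / m2 k))"
      unfolding sqrt_m1 m2_inverse by (rule summable_linear_geometric) auto
  qed
  \<comment> \<open>The ratio 1/12 is small enough for admissibility (below 1/8) and larger than 1/16.\<close>
  define e :: "nat \<Rightarrow> complex" where "e k = of_real ((1/12) ^ k)" for k
  have "cmod (e k) = (1/12) ^ k" for k
    unfolding e_def by (simp add: norm_power)
  note norm_e = this
  have "P.T.admissible e"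
    unfolding P.T.admissible_def norm_e m2_inverse by (rule summable_linear_geometric) auto
  moreover have "\<exists>k. K * sqrt (m1 k) < cmod (e k)" for K
  proof -
    obtain k where "K < (4/3) ^ k" using real_arch_pow[of "4/3" K] by auto
    then have "K * (1/16) ^ k < (4/3) ^ k * (1/16) ^ k" by (intro mult_strict_right_mono) auto
    also have "(4/3) ^ k * (1/16) ^ k = (1/12 :: real) ^ k" by (simp flip: power_mult_distrib)
    finally show ?thesis unfolding norm_e sqrt_m1 by blast
  qed
  ultimately have "pmult P.\<Psi> ` model_space P.B.clark_inner \<subset> model_space P.T.clark_inner"
    by (rule P.Psi_image_proper)
  moreover have "\<exists>z\<in>upper_half_plane. P.\<Psi> z \<noteq> 0"
    using P.Psi_nonzero[of "\<i>"] by (intro bexI[of _ "\<i>"]) (auto simp: upper_half_plane_def)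
  ultimately show ?thesis
    using P.B.inner_function_clark_inner P.T.inner_function_clark_inner P.Psi_Hol P.multipliers_eq by blast
qed

end
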